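(* Let $K$ be a field. Suppose that the following statement (Conjecture A) is true: (A) a graph is perfectly contractile if and only if it contains no odd holes, no antiholes and no odd prisms as induced subgraphs. Then the following statement (Conjecture B) is also true: (B) for every perfect graph $G$, the stable set ring $K[G]$ is quadratic if and only if $G$ contains no odd holes, no antiholes and no odd prisms as induced subgraphs.
   Context: Graphs are finite and simple. Perfect graphs: $\chi(H)$ is the chromatic number of $H$ and $\omega(H)$ is the maximum cardinality of a clique of $H$. A graph $G$ is perfect if $\chi(H)=\omega(H)$ for every induced subgraph $H$ of $G$. Forbidden subgraphs: a hole is an induced cycle of length $\ge 5$; an antihole is the complement of a hole. A hole is odd if its length is odd. An odd prism is a graph consisting of two disjoint triangles with three disjoint induced paths of odd length between them (each path joins a vertex of one triangle to a vertex of the other, and there are no further edges). Perfectly contractile graphs: an even pair in a graph $G$ is a pair of non-adjacent vertices such that all induced paths between them have even length. Contracting a pair of vertices $\{x,y\}$ means removing $x$ and $y$ and adding a new vertex $z$ adjacent to every (remaining) vertex that was a neighbor of $x$ or of $y$. A graph $G$ is even-contractile if there is a sequence of graphs $G=G_0,G_1,\dots,G_k$ such that each $G_i$ ($i\ge 1$) is obtained from $G_{i-1}$ by contracting an even pair of $G_{i-1}$, and $G_k$ is a complete graph. A graph $G$ is perfectly contractile if every induced subgraph of $G$ is even-contractile. Stable set ring: for a graph $G$ on $[n]=\{1,\dots,n\}$, a stable set is a subset of $[n]$ containing no two adjacent vertices (in particular $\emptyset$ and singletons are stable). Let $S_1,\dots,S_m$ be all the stable sets of $G$. The stable set ring is the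 subalgebra $K[G]=K[\,s\prod_{j\in S_1}t_j,\dots,s\prod_{j\in S_m}t_j\,]$ of the polynomial ring $K[t_1,\dots,t_n,s]$. The stable set ideal $I_G$ is the kernel of the surjective $K$-algebra homomorphism $K[x_1,\dots,x_m]\to K[G]$, $x_i\mapsto s\prod_{j\in S_i}t_j$, where $K[x_1,\dots,x_m]$ is the polynomial ring with $\deg x_i=1$. The ring $K[G]$ is called quadratic if $I_G$ is generated by quadratic (homogeneous degree 2) binomials; by convention this includes the case $I_G=\{0\}$. *)

theory Defs
  imports
    "HOL-Library.Poly_Mapping"
    "HOL-Algebra.Ideal"
    "HOL-Algebra.Generated_Rings"
begin

section \<open>Finite simple graphs\<close>

record 'a graph =
  verts :: "'a set"
  edges :: "'a set set"

definition simple_graph :: "'a graph \<Rightarrow> bool" where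
  "simple_graph G \<longleftrightarrow> finite (verts G) \<and> (\<forall>e \<in> edges G. e \<subseteq> verts G \<and> card e = 2)"

definition adj :: "'a graph \<Rightarrow> 'a \<Rightarrow> 'a \<Rightarrow> bool" where
  "adj G u v \<longleftrightarrow> {u, v} \<in> edges G"

definition induced :: "'a graph \<Rightarrow> 'a set \<Rightarrow> 'a graph" where
  "induced G W = \<lparr>verts = W, edges = {e \<in> edges G. e \<subseteq> W}\<rparr>"

definition complement :: "'a graph \<Rightarrow> 'a graph" where
  "complement G = \<lparr>verts = verts G, edges = {e. e \<subseteq> verts G \<and> card e = 2 \<and> e \<notin> edges G}\<rparr>"

definition complete_graph :: "'a graph \<Rightarrow> bool" where
  "complete_graph G \<longleftrightarrow> (\<forall>u \<in> verts G. \<forall>v \<in> verts G. u \<noteq> v \<longrightarrow> adj G u v)"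

definition contains_induced :: "('a graph \<Rightarrow> bool) \<Rightarrow> 'a graph \<Rightarrow> bool" where
  "contains_induced P G \<longleftrightarrow> (\<exists>W \<subseteq> verts G. P (induced G W))"


section \<open>Perfect graphs\<close>

definition colourable :: "'a graph \<Rightarrow> nat \<Rightarrow> bool" where
  "colourable G k \<longleftrightarrow>
     (\<exists>c :: 'a \<Rightarrow> nat. (\<forall>v \<in> verts G. c v < k) \<and>
        (\<forall>u \<in> verts G. \<forall>v \<in> verts G. adj G u v \<longrightarrow> c u \<noteq> c v))"

definition chromatic_number :: "'a graph \<Rightarrow> nat" where
  "chromatic_number G = (LEAST k. colourable G k)"

definition cliques :: "'a graph \<Rightarrow> 'a set set" where
  "cliques G = {C. C \<subseteq> verts G \<and> complete_graph (induced G C)}"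

definition clique_number :: "'a graph \<Rightarrow> nat" where
  "clique_number G = Max (card ` cliques G)"

definition perfect :: "'a graph \<Rightarrow> bool" where
  "perfect G \<longleftrightarrow>
     (\<forall>W \<subseteq> verts G. chromatic_number (induced G W) = clique_number (induced G W))"


section \<open>Holes, antiholes and odd prisms\<close>

text \<open>A path or a cycle is given by the list of its vertices in order; the path
  on the list \<open>p\<close> has length \<open>length p - 1\<close> and the cycle on \<open>p\<close> has length \<open>length p\<close>.\<close>

definition path_edges :: "'a list \<Rightarrow> 'a set set" where
  "path_edges p = {{p ! i, p ! Suc i} | i. Suc i < length p}"

definition is_cycle :: "nat \<Rightarrow> 'a graph \<Rightarrow> bool" where
  "is_cycle n G \<longleftrightarrow> 3 \<le> n \<and>
     (\<exists>p. length p = n \<and> distinct p \<and> verts G = set p \<and>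
          edges G = insert {last p, hd p} (path_edges p))"

definition is_hole :: "'a graph \<Rightarrow> bool" where
  "is_hole G \<longleftrightarrow> (\<exists>n \<ge> 5. is_cycle n G)"

definition is_odd_hole :: "'a graph \<Rightarrow> bool" where
  "is_odd_hole G \<longleftrightarrow> (\<exists>n \<ge> 5. odd n \<and> is_cycle n G)"

definition is_antihole :: "'a graph \<Rightarrow> bool" where
  "is_antihole G \<longleftrightarrow> is_hole (complement G)"

definition triangle_edges :: "'a \<Rightarrow> 'a \<Rightarrow> 'a \<Rightarrow> 'a set set" where
  "triangle_edges a b c = {{a, b}, {b, c}, {a, c}}"

text \<open>The three paths \<open>p\<close>, \<open>q\<close>, \<open>r\<close> have odd length, that is, a positive even number of
  vertices, so the two triangles formed by their first and by their last vertices are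
  disjoint. The paths are induced because there are no further edges.\<close>

definition is_odd_prism :: "'a graph \<Rightarrow> bool" where
  "is_odd_prism G \<longleftrightarrow>
     (\<exists>p q r. distinct (p @ q @ r) \<and>
        (\<forall>l \<in> {p, q, r}. l \<noteq> [] \<and> odd (length l - 1)) \<and>
        verts G = set p \<union> set q \<union> set r \<and>
        edges G = path_edges p \<union> path_edges q \<union> path_edges r
          \<union> triangle_edges (hd p) (hd q) (hd r) \<union> triangle_edges (last p) (last q) (last r))"


section \<open>Perfectly contractile graphs\<close>

definition induced_path :: "'a graph \<Rightarrow> 'a list \<Rightarrow> 'a \<Rightarrow> 'a \<Rightarrow> bool" where
  "induced_path G p x y \<longleftrightarrow>
     p \<noteq> [] \<and> distinct p \<and> set p \<subseteq> verts G \<and> hd p = x \<and> last p = y \<and>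
     edges (induced G (set p)) = path_edges p"

definition even_pair :: "'a graph \<Rightarrow> 'a \<Rightarrow> 'a \<Rightarrow> bool" where
  "even_pair G x y \<longleftrightarrow>
     x \<in> verts G \<and> y \<in> verts G \<and> x \<noteq> y \<and> \<not> adj G x y \<and>
     (\<forall>p. induced_path G p x y \<longrightarrow> even (length p - 1))"

definition contract :: "'a graph \<Rightarrow> 'a \<Rightarrow> 'a \<Rightarrow> 'a \<Rightarrow> 'a graph" where
  "contract G x y z =
     \<lparr>verts = insert z (verts G - {x, y}),
      edges = {e \<in> edges G. x \<notin> e \<and> y \<notin> e}
        \<union> {{z, v} | v. v \<in> verts G - {x, y} \<and> (adj G x v \<or> adj G y v)}\<rparr>"

text \<open>The contracted vertex \<open>z\<close> is new. Over an infinite type of vertices such a \<open>z\<close>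
  always exists for a finite graph; over a finite type the following definitions would
  be too restrictive.\<close>

definition even_contraction :: "'a graph \<Rightarrow> 'a graph \<Rightarrow> bool" where
  "even_contraction G H \<longleftrightarrow>
     (\<exists>x y z. even_pair G x y \<and> z \<notin> verts G \<and> H = contract G x y z)"

definition even_contractile :: "'a graph \<Rightarrow> bool" where
  "even_contractile G \<longleftrightarrow> (\<exists>H. even_contraction\<^sup>*\<^sup>* G H \<and> complete_graph H)"

definition perfectly_contractile :: "'a graph \<Rightarrow> bool" where
  "perfectly_contractile G \<longleftrightarrow> (\<forall>W \<subseteq> verts G. even_contractile (induced G W))"


section \<open>Polynomial rings\<close>

text \<open>Polynomials with variables in \<open>'v\<close> are finitely supported functions from monomials
  (exponent vectors) to coefficients, with the convolution product.\<close>

type_synonym ('v, 'k) mpoly = "('v \<Rightarrow>\<^sub>0 nat) \<Rightarrow>\<^sub>0 'k"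

definition const :: "'k::field \<Rightarrow> ('v, 'k) mpoly" where
  "const c = Poly_Mapping.single 0 c"

definition var :: "'v \<Rightarrow> ('v, 'k::field) mpoly" where
  "var v = Poly_Mapping.single (Poly_Mapping.single v 1) 1"

definition poly_ring :: "'v set \<Rightarrow> ('v, 'k::field) mpoly ring" where
  "poly_ring X =
     \<lparr>carrier = {f. \<forall>m \<in> Poly_Mapping.keys f. Poly_Mapping.keys m \<subseteq> X},
      monoid.mult = (*), one = 1, zero = 0, add = (+)\<rparr>"

text \<open>The \<open>K\<close>-algebra homomorphism that sends each variable \<open>v\<close> to \<open>h v\<close>.\<close>

definition poly_subst :: "('v \<Rightarrow> ('w, 'k::field) mpoly) \<Rightarrow> ('v, 'k) mpoly \<Rightarrow> ('w, 'k) mpoly" where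
  "poly_subst h f =
     (\<Sum>m \<in> Poly_Mapping.keys f. const (Poly_Mapping.lookup f m)
        * (\<Prod>v \<in> Poly_Mapping.keys m. h v ^ Poly_Mapping.lookup m v))"

definition subalgebra_gen :: "'v set \<Rightarrow> ('v, 'k::field) mpoly set \<Rightarrow> ('v, 'k) mpoly ring" where
  "subalgebra_gen X A =
     (poly_ring X) \<lparr>carrier := generate_ring (poly_ring X) (range const \<union> A)\<rparr>"

definition monom_degree :: "('v \<Rightarrow>\<^sub>0 nat) \<Rightarrow> nat" where
  "monom_degree m = (\<Sum>v \<in> Poly_Mapping.keys m. Poly_Mapping.lookup m v)"

definition quadratic_binomials :: "'v set \<Rightarrow> ('v, 'k::field) mpoly set" where
  "quadratic_binomials X =
     {Poly_Mapping.single u 1 - Poly_Mapping.single w 1 | u w.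
        u \<noteq> w \<and> Poly_Mapping.keys u \<subseteq> X \<and> Poly_Mapping.keys w \<subseteq> X \<and>
        monom_degree u = 2 \<and> monom_degree w = 2}"


section \<open>Stable set rings\<close>

definition stable_sets :: "'a graph \<Rightarrow> 'a set set" where
  "stable_sets G = {S. S \<subseteq> verts G \<and> (\<forall>u \<in> S. \<forall>v \<in> S. \<not> adj G u v)}"

text \<open>The variables \<open>t\<^sub>j\<close>, for \<open>j\<close> a vertex, and \<open>s\<close>.\<close>

datatype 'a tsvar = Tvar 'a | Svar

definition stable_monomial :: "'a set \<Rightarrow> ('a tsvar, 'k::field) mpoly" where
  "stable_monomial A = var Svar * (\<Prod>j \<in> A. var (Tvar j))"

definition stable_set_ring :: "'k::field itself \<Rightarrow> 'a graph \<Rightarrow> ('a tsvar, 'k) mpoly ring" where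
  "stable_set_ring K G =
     subalgebra_gen (insert Svar (Tvar ` verts G)) (stable_monomial ` stable_sets G)"

text \<open>The variables of the presenting polynomial ring are indexed by the stable sets
  themselves rather than by an enumeration of them.\<close>

definition stable_set_ideal :: "'k::field itself \<Rightarrow> 'a graph \<Rightarrow> ('a set, 'k) mpoly set" where
  "stable_set_ideal K G =
     a_kernel (poly_ring (stable_sets G)) (stable_set_ring K G) (poly_subst stable_monomial)"

text \<open>The set \<open>B\<close> of generators may be empty, which covers the zero ideal.\<close>

definition quadratic_stable_set_ring :: "'k::field itself \<Rightarrow> 'a graph \<Rightarrow> bool" where
  "quadratic_stable_set_ring K G \<longleftrightarrow>
     (\<exists>B \<subseteq> quadratic_binomials (stable_sets G).
        stable_set_ideal K G = Idl\<^bsub>poly_ring (stable_sets G)\<^esub> B)"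

end

theory Submission
  imports Defs
begin

text \<open>A monomial of degree \<open>k\<close> in the variables indexed by the stable sets is a multiset of
\<open>k\<close> stable sets, and its image in \<open>K[G]\<close> records how often every vertex
is covered. Replace every vertex by a clique with as many copies as it is covered times: the
monomials with a given image are then the \<open>k\<close>-colourings of this replication of
\<open>G\<close>, up to the names of the colours and of the copies. A quadratic binomial exchanges
two colour classes for two others with the same union. Such exchanges are what Kempe changes
generate, so \<open>K[G]\<close> is quadratic as soon as all \<open>k\<close>-colourings of all
replications of \<open>G\<close> are Kempe equivalent
(\<open>quadratic_if_kempe_equivalent\<close>).

Suppose that \<open>G\<close> contains no odd hole, no antihole and no odd prism. Copies of the
same vertex are adjacent and have the same other neighbours, and none of the three kinds of graphs
has two such vertices, so an induced copy in a replication would project to an induced copy in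
\<open>G\<close>. Hence no replication contains them either
(\<open>forbidden_replication\<close>), and by the assumed characterization of perfectly
contractile graphs every replication is even contractile. In an even contractile graph all
\<open>k\<close>-colourings are Kempe equivalent
(\<open>even_contractile_kempe_equivalent\<close>): the two vertices of an even pair can be given
the same colour by one Kempe change, because a two-coloured chain between differently coloured
vertices would contain an induced path of odd length; then the colouring lives on the contracted
graph.

For the converse, consider a cover of vertices by stable sets such that the symmetric difference
of any two of them induces a connected graph. A connected bipartite graph has only one partition
into two stable sets, so no quadratic binomial of the ideal applies to the corresponding monomial,
and the ideal is not quadratic if the same cover multiplicities are attained by another family
(\<open>not_quadratic_if_rigid\<close>). An antihole with an even number of vertices has such
covers: the two perfect matchings of the complementary cycle. An odd prism has them too: one
triple of stable sets for each of the two cyclic orders of its three paths. Holes and antiholes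
with an odd number \<open>n\<close> of vertices are excluded by perfection, since in a perfect
graph the number of vertices is at most the product of the sizes of a largest stable set and a
largest clique, and these sizes are \<open>2\<close> and \<open>(n - 1) / 2\<close> in some order.\<close>

section \<open>The stable set ideal\<close>

lemma keys_uminus: "Poly_Mapping.keys (- f :: 'a \<Rightarrow>\<^sub>0 'b::ab_group_add) = Poly_Mapping.keys f"
  by (auto simp: in_keys_iff)

lemma keys_binomial:
  "u \<noteq> w \<Longrightarrow> Poly_Mapping.keys (Poly_Mapping.single u 1 - Poly_Mapping.single w (1::'k::field)) = {u, w}"
  by (auto simp: in_keys_iff lookup_minus lookup_single when_def split: if_splits)

lemma ring_poly_ring: "ring (poly_ring X :: ('v, 'k::field) mpoly ring)"
proof (rule ringI)
  show "abelian_group (poly_ring X :: ('v, 'k) mpoly ring)"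
  proof (rule abelian_groupI)
    fix f :: "('v, 'k) mpoly" assume "f \<in> carrier (poly_ring X)"
    then have "- f \<in> carrier (poly_ring X) \<and> - f + f = 0"
      by (auto simp: poly_ring_def keys_uminus)
    then show "\<exists>g \<in> carrier (poly_ring X). g \<oplus>\<^bsub>poly_ring X\<^esub> f = \<zero>\<^bsub>poly_ring X\<^esub>"
      by (intro bexI[of _ "- f"]) (simp_all add: poly_ring_def)
  next
    fix f g :: "('v, 'k) mpoly"
    assume "f \<in> carrier (poly_ring X)" "g \<in> carrier (poly_ring X)"
    then show "f \<oplus>\<^bsub>poly_ring X\<^esub> g \<in> carrier (poly_ring X)"
      using Poly_Mapping.keys_add[of f g] by (fastforce simp: poly_ring_def)
  qed (auto simp: poly_ring_def add_ac)
  show "Group.monoid (poly_ring X :: ('v, 'k) mpoly ring)"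
  proof (rule monoidI)
    fix f g :: "('v, 'k) mpoly"
    assume fg: "f \<in> carrier (poly_ring X)" "g \<in> carrier (poly_ring X)"
    have "Poly_Mapping.keys m \<subseteq> X" if mk: "m \<in> Poly_Mapping.keys (f * g)" for m
    proof -
      obtain a b where "m = a + b" "a \<in> Poly_Mapping.keys f" "b \<in> Poly_Mapping.keys g"
        using keys_mult[of f g] mk by blast
      then show ?thesis
        using fg Poly_Mapping.keys_add[of a b] by (fastforce simp: poly_ring_def)
    qed
    then show "f \<otimes>\<^bsub>poly_ring X\<^esub> g \<in> carrier (poly_ring X)"
      by (simp add: poly_ring_def)
  qed (auto simp: poly_ring_def mult.assoc)
qed (auto simp: poly_ring_def algebra_simps)

text \<open>Closure under negation comes for free, as \<open>- 1\<close> is a polynomial.\<close>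

lemma poly_ring_idealI:
  fixes J :: "('v, 'k::field) mpoly set"
  assumes sub: "J \<subseteq> carrier (poly_ring X)" and zero: "0 \<in> J"
    and add: "\<And>f g. f \<in> J \<Longrightarrow> g \<in> J \<Longrightarrow> f + g \<in> J"
    and mult: "\<And>f g. f \<in> carrier (poly_ring X) \<Longrightarrow> g \<in> J \<Longrightarrow> f * g \<in> J"
  shows "ideal J (poly_ring X)"
proof (rule idealI[OF ring_poly_ring])
  have uminus: "- f \<in> J" if "f \<in> J" for f
    using mult[of "-1" f] that by (auto simp: poly_ring_def)
  have inv: "inv\<^bsub>add_monoid (poly_ring X)\<^esub> f = - f" if "f \<in> J" for f
  proof -
    interpret ring "poly_ring X :: ('v, 'k) mpoly ring" by (rule ring_poly_ring)
    have "- f \<in> carrier (poly_ring X)" "f \<in> carrier (poly_ring X)" 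
      using uminus[OF that] that sub by auto
    moreover have "- f \<oplus>\<^bsub>poly_ring X\<^esub> f = \<zero>\<^bsub>poly_ring X\<^esub>"
      by (simp add: poly_ring_def)
    ultimately have "\<ominus>\<^bsub>poly_ring X\<^esub> f = - f" by (metis minus_equality)
    then show ?thesis by (simp add: a_inv_def)
  qed
  show "subgroup J (add_monoid (poly_ring X))"
    by unfold_locales (use sub zero add inv uminus in \<open>auto simp: poly_ring_def\<close>)
  fix g f :: "('v, 'k) mpoly" assume "g \<in> J" "f \<in> carrier (poly_ring X)"
  then show "f \<otimes>\<^bsub>poly_ring X\<^esub> g \<in> J" "g \<otimes>\<^bsub>poly_ring X\<^esub> f \<in> J"
    using mult[of f g] by (simp_all add: poly_ring_def mult.commute)
qed

lemma poly_mapping_sum_single: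
  "f = (\<Sum>m \<in> Poly_Mapping.keys f. Poly_Mapping.single m (Poly_Mapping.lookup f m))"
proof (rule poly_mapping_eqI)
  fix k
  have "(\<Sum>m \<in> Poly_Mapping.keys f. Poly_Mapping.lookup f m when m = k)
      = (if k \<in> Poly_Mapping.keys f then Poly_Mapping.lookup f k else 0)"
    by (simp add: when_def sum.delta)
  then show "Poly_Mapping.lookup f k = Poly_Mapping.lookup
      (\<Sum>m \<in> Poly_Mapping.keys f. Poly_Mapping.single m (Poly_Mapping.lookup f m)) k"
    by (auto simp: lookup_sum lookup_single in_keys_iff)
qed

text \<open>The exponent vector of the monomial \<open>stable_monomial A\<close>.\<close>

definition set_exponent :: "'a set \<Rightarrow> 'a tsvar \<Rightarrow>\<^sub>0 nat" where
  "set_exponent A = Poly_Mapping.single Svar 1 + (\<Sum>j \<in> A. Poly_Mapping.single (Tvar j) 1)"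

definition scale_exponent :: "nat \<Rightarrow> ('v \<Rightarrow>\<^sub>0 nat) \<Rightarrow> 'v \<Rightarrow>\<^sub>0 nat" where
  "scale_exponent n e = Poly_Mapping.map ((*) n) e"

text \<open>Substitution of the \<open>stable_monomial A\<close> for the variables sends monomials to monomials; this is
  the induced additive map on exponent vectors. The coordinate at \<open>Svar\<close> is the degree, the one at
  \<open>Tvar v\<close> counts the stable sets that contain \<open>v\<close>.\<close>

definition image_exponent :: "('a set \<Rightarrow>\<^sub>0 nat) \<Rightarrow> 'a tsvar \<Rightarrow>\<^sub>0 nat" where
  "image_exponent m =
     (\<Sum>A \<in> Poly_Mapping.keys m. scale_exponent (Poly_Mapping.lookup m A) (set_exponent A))"

lemma lookup_scale_exponent [simp]:
  "Poly_Mapping.lookup (scale_exponent n e) x = n * Poly_Mapping.lookup e x"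
  by (auto simp: scale_exponent_def map.rep_eq when_def)

lemma scale_exponent_add: "scale_exponent (m + n) e = scale_exponent m e + scale_exponent n e"
  by (rule poly_mapping_eqI) (simp add: lookup_add algebra_simps)

lemma scale_exponent_0 [simp]: "scale_exponent 0 e = 0"
  by (rule poly_mapping_eqI) simp

lemma scale_exponent_1 [simp]: "scale_exponent (Suc 0) e = e"
  by (rule poly_mapping_eqI) simp

lemma prod_single_1:
  "(\<Prod>i \<in> I. Poly_Mapping.single (e i) (1::'k::field)) = Poly_Mapping.single (\<Sum>i \<in> I. e i) 1"
  by (induction I rule: infinite_finite_induct) (simp_all add: mult_single)

lemma single_1_power:
  "Poly_Mapping.single e (1::'k::field) ^ n = Poly_Mapping.single (scale_exponent n e) 1"
  using scale_exponent_add[of 1 _ e]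
  by (induction n) (simp_all add: mult_single)

lemma stable_monomial_eq:
  "stable_monomial A = (Poly_Mapping.single (set_exponent A) 1 :: ('a tsvar, 'k::field) mpoly)"
  by (simp add: stable_monomial_def var_def set_exponent_def prod_single_1 mult_single)

lemma poly_subst_stable_monomial:
  "poly_subst stable_monomial f =
     (\<Sum>m \<in> Poly_Mapping.keys f. Poly_Mapping.single (image_exponent m) (Poly_Mapping.lookup f m))"
  unfolding poly_subst_def stable_monomial_eq const_def image_exponent_def single_1_power
    prod_single_1 by (simp add: mult_single)

lemma image_exponent_0 [simp]: "image_exponent 0 = 0"
  by (simp add: image_exponent_def)

lemma image_exponent_add: "image_exponent (m + n) = image_exponent m + image_exponent n"
  unfolding image_exponent_def
  by (rule setsum_keys_plus_distrib) (simp_all add: scale_exponent_add)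

lemma image_exponent_single [simp]: "image_exponent (Poly_Mapping.single A (Suc 0)) = set_exponent A"
  by (simp add: image_exponent_def)

lemma image_exponent_sum: "image_exponent (\<Sum>i \<in> I. m i) = (\<Sum>i \<in> I. image_exponent (m i))"
  by (induction I rule: infinite_finite_induct) (simp_all add: image_exponent_add)

lemma poly_subst_single [simp]:
  "poly_subst stable_monomial (Poly_Mapping.single m c) = Poly_Mapping.single (image_exponent m) c"
  by (simp add: poly_subst_stable_monomial)

lemma poly_subst_add:
  "poly_subst stable_monomial (f + g) = poly_subst stable_monomial f + poly_subst stable_monomial g"
  unfolding poly_subst_stable_monomial
  by (rule setsum_keys_plus_distrib) (simp_all add: single_add)

lemma poly_subst_0 [simp]: "poly_subst h 0 = 0"
  by (simp add: poly_subst_def)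

lemma poly_subst_sum:
  "poly_subst stable_monomial (\<Sum>i \<in> I. f i) = (\<Sum>i \<in> I. poly_subst stable_monomial (f i))"
  by (induction I rule: infinite_finite_induct) (simp_all add: poly_subst_add)

lemma poly_subst_diff:
  "poly_subst stable_monomial (f - g) = poly_subst stable_monomial f - poly_subst stable_monomial g"
  using poly_subst_add[of "f - g" g] by (simp add: algebra_simps)

lemma poly_subst_mult:
  fixes f g :: "('a set, 'k::field) mpoly"
  shows "poly_subst stable_monomial (f * g) = poly_subst stable_monomial f * poly_subst stable_monomial g"
proof -
  let ?s = "\<lambda>f m. Poly_Mapping.single m (Poly_Mapping.lookup f m) :: ('a set, 'k) mpoly"
  have "f * g = (\<Sum>m \<in> Poly_Mapping.keys f. ?s f m) * (\<Sum>n \<in> Poly_Mapping.keys g. ?s g n)"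
    by (simp flip: poly_mapping_sum_single)
  also have "\<dots> = (\<Sum>m \<in> Poly_Mapping.keys f. \<Sum>n \<in> Poly_Mapping.keys g. ?s f m * ?s g n)"
    by (rule sum_product)
  finally have "poly_subst stable_monomial (f * g) =
    (\<Sum>m \<in> Poly_Mapping.keys f. \<Sum>n \<in> Poly_Mapping.keys g. poly_subst stable_monomial (?s f m * ?s g n))"
    by (simp add: poly_subst_sum)
  also have "\<dots> = poly_subst stable_monomial f * poly_subst stable_monomial g"
    by (simp add: poly_subst_stable_monomial[of f] poly_subst_stable_monomial[of g] sum_product
        mult_single image_exponent_add)
  finally show ?thesis .
qed

lemma mem_stable_set_ideal_iff:
  "f \<in> stable_set_ideal K G \<longleftrightarrow>
     f \<in> carrier (poly_ring (stable_sets G)) \<and> poly_subst stable_monomial f = 0"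
  by (simp add: stable_set_ideal_def a_kernel_def' stable_set_ring_def subalgebra_gen_def poly_ring_def)

lemma ideal_stable_set_ideal: "ideal (stable_set_ideal K G) (poly_ring (stable_sets G))"
proof (rule poly_ring_idealI)
  fix f g assume "f \<in> stable_set_ideal K G" "g \<in> stable_set_ideal K G"
  then show "f + g \<in> stable_set_ideal K G"
    using Poly_Mapping.keys_add[of f g]
    by (auto simp: mem_stable_set_ideal_iff poly_ring_def poly_subst_add; blast)
next
  fix f g :: "('a set, 'b) mpoly"
  assume f: "f \<in> carrier (poly_ring (stable_sets G))" and g: "g \<in> stable_set_ideal K G"
  interpret ring "poly_ring (stable_sets G) :: ('a set, 'b) mpoly ring" by (rule ring_poly_ring)
  have "f * g \<in> carrier (poly_ring (stable_sets G))"
    using m_closed[OF f, of g] g by (simp add: mem_stable_set_ideal_iff) (simp add: poly_ring_def)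
  then show "f * g \<in> stable_set_ideal K G"
    using g by (simp add: mem_stable_set_ideal_iff poly_subst_mult)
next
  show "stable_set_ideal K G \<subseteq> carrier (poly_ring (stable_sets G))" "0 \<in> stable_set_ideal K G"
    unfolding subset_iff mem_stable_set_ideal_iff by (simp_all add: poly_ring_def)
qed

lemma binomial_mem_stable_set_ideal_iff:
  assumes "u \<noteq> w"
  shows "Poly_Mapping.single u 1 - Poly_Mapping.single w 1 \<in> stable_set_ideal K G \<longleftrightarrow>
    Poly_Mapping.keys u \<subseteq> stable_sets G \<and> Poly_Mapping.keys w \<subseteq> stable_sets G \<and>
    image_exponent u = image_exponent w"
proof -
  have "Poly_Mapping.keys (Poly_Mapping.single u 1 - Poly_Mapping.single w 1 :: ('a set, 'b) mpoly) = {u, w}"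
    using assms by (rule keys_binomial)
  moreover have "Poly_Mapping.single a (1::'b) = Poly_Mapping.single b 1 \<longleftrightarrow> a = b" for a b :: "'a tsvar \<Rightarrow>\<^sub>0 nat"
    by (metis keys_single singleton_insert_inj_eq' zero_neq_one)
  ultimately show ?thesis
    by (auto simp: mem_stable_set_ideal_iff poly_subst_diff poly_ring_def)
qed

text \<open>The stable set ideal is spanned by binomials. A polynomial of the ideal cannot have only one term
  over a given image, so one of its terms can be merged with another one over the same image by
  subtracting a multiple of a binomial; induction on the number of terms does the rest.\<close>

lemma stable_set_ideal_subset:
  assumes J: "ideal J (poly_ring (stable_sets G))"
    and bin: "\<And>u w. \<lbrakk>Poly_Mapping.keys u \<subseteq> stable_sets G; Poly_Mapping.keys w \<subseteq> stable_sets G;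
       image_exponent u = image_exponent w\<rbrakk>
      \<Longrightarrow> Poly_Mapping.single u 1 - Poly_Mapping.single w 1 \<in> J"
  shows "stable_set_ideal (K :: 'k::field itself) G \<subseteq> J"
proof
  fix f assume "f \<in> stable_set_ideal K G"
  then show "f \<in> J"
  proof (induction "card (Poly_Mapping.keys f)" arbitrary: f rule: less_induct)
    case less
    interpret J: ideal J "poly_ring (stable_sets G)" by (rule J)
    interpret I: ideal "stable_set_ideal K G" "poly_ring (stable_sets G)" by (rule ideal_stable_set_ideal)
    show ?case
    proof (cases "f = 0")
      case True then show ?thesis using additive_subgroup.zero_closed[OF J.is_additive_subgroup] by (simp add: poly_ring_def)
    next
      case False
      then obtain m where m: "m \<in> Poly_Mapping.keys f" by (metis ex_in_conv keys_eq_empty)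
      have "\<exists>m' \<in> Poly_Mapping.keys f. m' \<noteq> m \<and> image_exponent m' = image_exponent m"
      proof (rule ccontr)
        assume no: "\<not> ?thesis"
        have "Poly_Mapping.lookup (poly_subst stable_monomial f) (image_exponent m)
          = (\<Sum>m' \<in> Poly_Mapping.keys f. Poly_Mapping.lookup f m' when image_exponent m' = image_exponent m)"
          by (simp add: poly_subst_stable_monomial lookup_sum lookup_single)
        also have "\<dots> = (\<Sum>m' \<in> Poly_Mapping.keys f. Poly_Mapping.lookup f m' when m' = m)"
          using no by (intro sum.cong) (auto simp: when_def)
        also have "\<dots> = Poly_Mapping.lookup f m" using m by (simp add: when_def)
        finally show False using less.prems m by (simp add: mem_stable_set_ideal_iff in_keys_iff)
      qed
      then obtain m' where m': "m' \<in> Poly_Mapping.keys f" "m' \<noteq> m" "image_exponent m' = image_exponent m"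
        by blast
      define b :: "('a set, 'k) mpoly" where "b = Poly_Mapping.single m 1 - Poly_Mapping.single m' 1"
      \<comment> \<open>The multiple \<open>c * b\<close> moves the whole term at \<open>m\<close> to \<open>m'\<close>, which is already a key.\<close>
      define c where "c = (Poly_Mapping.single 0 (Poly_Mapping.lookup f m) :: ('a set, 'k) mpoly)"
      have keys: "Poly_Mapping.keys m \<subseteq> stable_sets G" "Poly_Mapping.keys m' \<subseteq> stable_sets G"
        using less.prems m m' by (auto simp: mem_stable_set_ideal_iff poly_ring_def)
      have c: "c \<in> carrier (poly_ring (stable_sets G))" by (simp add: poly_ring_def c_def)
      have bJ: "b \<in> J" unfolding b_def using bin keys m' by simp
      have bI: "b \<in> stable_set_ideal K G" unfolding b_def
        using keys m' binomial_mem_stable_set_ideal_iff[of m m' K G] by simp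
      have cb: "c * b = Poly_Mapping.single m (Poly_Mapping.lookup f m) - Poly_Mapping.single m' (Poly_Mapping.lookup f m)"
        by (simp add: c_def b_def right_diff_distrib mult_single)
      have "Poly_Mapping.keys (f - c * b) \<subseteq> Poly_Mapping.keys f - {m}"
        using m' by (auto simp: in_keys_iff cb lookup_minus lookup_single when_def split: if_splits)
      then have "card (Poly_Mapping.keys (f - c * b)) < card (Poly_Mapping.keys f)"
        by (meson card_Diff1_less card_mono finite_Diff finite_keys le_less_trans m)
      moreover have "c * b \<in> stable_set_ideal K G" "c * b \<in> J"
        using I.I_l_closed[OF bI c] J.I_l_closed[OF bJ c] by (simp_all add: poly_ring_def)
      moreover from this(1) have "f - c * b \<in> stable_set_ideal K G"
        using less.prems additive_subgroup.a_closed[OF I.is_additive_subgroup, of f "(- 1) * (c * b)"]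
          I.I_l_closed[of "c * b" "- 1"]
        by (auto simp add: poly_ring_def keys_uminus)
      ultimately have "f - c * b \<in> J" "c * b \<in> J" using less.hyps by blast+
      from additive_subgroup.a_closed[OF J.is_additive_subgroup this] show ?thesis by (simp add: poly_ring_def)
    qed
  qed
qed

text \<open>If no quadratic binomial of the ideal can be applied to the monomial \<open>u\<close>, then all these binomials
  lie in the monomial ideal of the polynomials none of whose terms divides \<open>u\<close>. The binomial of \<open>u\<close>
  and \<open>w\<close> belongs to the stable set ideal but not to this monomial ideal.\<close>

lemma isolated_monomial_not_quadratic:
  assumes u: "Poly_Mapping.keys u \<subseteq> stable_sets G" and w: "Poly_Mapping.keys w \<subseteq> stable_sets G"
    and uw: "u \<noteq> w" "image_exponent u = image_exponent w"
    and isolated: "\<And>a b c. \<lbrakk>u = a + c; monom_degree a = 2; monom_degree b = 2;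
      Poly_Mapping.keys a \<subseteq> stable_sets G; Poly_Mapping.keys b \<subseteq> stable_sets G;
      image_exponent a = image_exponent b\<rbrakk> \<Longrightarrow> a = b"
  shows "\<not> quadratic_stable_set_ring (K :: 'k::field itself) G"
proof
  assume "quadratic_stable_set_ring K G"
  then obtain B where B: "B \<subseteq> quadratic_binomials (stable_sets G)"
      and I: "stable_set_ideal K G = Idl\<^bsub>poly_ring (stable_sets G)\<^esub> B"
    unfolding quadratic_stable_set_ring_def by blast
  define J where "J = {f \<in> carrier (poly_ring (stable_sets G) :: ('a set, 'k) mpoly ring).
     \<forall>m \<in> Poly_Mapping.keys f. \<forall>c. u \<noteq> m + c}"
  interpret R: ring "poly_ring (stable_sets G) :: ('a set, 'k) mpoly ring" by (rule ring_poly_ring)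
  have "ideal J (poly_ring (stable_sets G))"
  proof (rule poly_ring_idealI)
    fix f g assume "f \<in> J" "g \<in> J"
    then show "f + g \<in> J"
      using Poly_Mapping.keys_add[of f g] R.a_closed[of f g] unfolding J_def
      by (auto simp: poly_ring_def; blast)
  next
    fix f g :: "('a set, 'k) mpoly"
    assume f: "f \<in> carrier (poly_ring (stable_sets G))" and g: "g \<in> J"
    have "f * g \<in> carrier (poly_ring (stable_sets G))"
      using R.m_closed[OF f, of g] g by (simp add: J_def) (simp add: poly_ring_def)
    moreover have "u \<noteq> m + c" if mk: "m \<in> Poly_Mapping.keys (f * g)" for m c
    proof -
      obtain a b where "m = a + b" "b \<in> Poly_Mapping.keys g"
        using keys_mult[of f g] mk by blast
      then show ?thesis using g by (auto simp: J_def add.assoc add.left_commute[of a])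
    qed
    ultimately show "f * g \<in> J" by (simp add: J_def)
  qed (auto simp: J_def poly_ring_def)
  moreover have "B \<subseteq> J"
  proof
    fix f assume f: "f \<in> B"
    then obtain a b where ab: "f = Poly_Mapping.single a 1 - Poly_Mapping.single b 1" "a \<noteq> b"
       "monom_degree a = 2" "monom_degree b = 2"
       "Poly_Mapping.keys a \<subseteq> stable_sets G" "Poly_Mapping.keys b \<subseteq> stable_sets G"
      using B unfolding quadratic_binomials_def by blast
    have carr: "B \<subseteq> carrier (poly_ring (stable_sets G))"
    proof
      fix g assume "g \<in> B"
      then obtain a b where ab: "g = Poly_Mapping.single a 1 - Poly_Mapping.single b 1"
         "Poly_Mapping.keys a \<subseteq> stable_sets G" "Poly_Mapping.keys b \<subseteq> stable_sets G" "a \<noteq> b"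
        using B unfolding quadratic_binomials_def by blast
      then show "g \<in> carrier (poly_ring (stable_sets G))"
        by (simp add: poly_ring_def keys_binomial)
    qed
    then have fI: "f \<in> stable_set_ideal K G" using R.genideal_self I f by blast
    then have im: "image_exponent a = image_exponent b"
      using ab binomial_mem_stable_set_ideal_iff[of a b K G] by simp
    have "Poly_Mapping.keys f \<subseteq> {a, b}"
      using ab by (auto simp: in_keys_iff lookup_minus lookup_single when_def split: if_splits)
    moreover have "u \<noteq> a + c" "u \<noteq> b + c" for c
      using isolated[of a c b] isolated[of b c a] ab im by auto
    ultimately show "f \<in> J" using carr f unfolding J_def by blast
  qed
  ultimately have "stable_set_ideal K G \<subseteq> J" unfolding I by (rule R.genideal_minimal)
  moreover have "Poly_Mapping.single u 1 - Poly_Mapping.single w 1 \<in> stable_set_ideal K G"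
    using u w uw binomial_mem_stable_set_ideal_iff[of u w K G] by simp
  moreover have "u \<in> Poly_Mapping.keys (Poly_Mapping.single u 1 - Poly_Mapping.single w 1 :: ('a set, 'k) mpoly)"
    using uw(1) by (simp add: in_keys_iff lookup_minus lookup_single when_def)
  ultimately have "u \<noteq> u + 0" unfolding J_def by blast
  then show False by simp
qed

lemma monom_degree_add: "monom_degree (u + w) = monom_degree u + monom_degree w"
  unfolding monom_degree_def by (rule setsum_keys_plus_distrib) simp_all

lemma monom_degree_single [simp]: "monom_degree (Poly_Mapping.single x n) = n"
  by (simp add: monom_degree_def)

lemma monom_degree_sum: "finite I \<Longrightarrow> monom_degree (\<Sum>i \<in> I. u i) = (\<Sum>i \<in> I. monom_degree (u i))"
  by (induction I rule: finite_induct) (simp_all add: monom_degree_add monom_degree_def[of 0])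

section \<open>Kempe equivalence in even contractile graphs\<close>

definition proper_colouring :: "'a graph \<Rightarrow> nat \<Rightarrow> ('a \<Rightarrow> nat) \<Rightarrow> bool" where
  "proper_colouring G k c \<longleftrightarrow>
     (\<forall>v \<in> verts G. c v < k) \<and> (\<forall>u \<in> verts G. \<forall>v \<in> verts G. adj G u v \<longrightarrow> c u \<noteq> c v)"

text \<open>A step may recolour the union of two colour classes in any proper way with the same two colours,
  that is, it performs Kempe changes on several components at once. This is the form that matches
  quadratic binomials, and unlike a single Kempe change it survives the splitting of a contracted
  vertex.\<close>

definition kempe_step :: "'a graph \<Rightarrow> nat \<Rightarrow> ('a \<Rightarrow> nat) \<Rightarrow> ('a \<Rightarrow> nat) \<Rightarrow> bool" where
  "kempe_step G k c d \<longleftrightarrow> proper_colouring G k c \<and> proper_colouring G k d \<and>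
     (\<exists>i j. \<forall>v \<in> verts G. if c v \<in> {i, j} then d v \<in> {i, j} else d v = c v)"

lemma kempe_step_eqI:
  assumes "proper_colouring G k c" "proper_colouring G k d" "\<And>v. v \<in> verts G \<Longrightarrow> c v = d v"
  shows "kempe_step G k c d"
  using assms unfolding kempe_step_def by auto

lemma kempe_step_sym:
  assumes "kempe_step G k c d"
  shows "kempe_step G k d c"
proof -
  from assms obtain i j where ij: "\<forall>v \<in> verts G. if c v \<in> {i, j} then d v \<in> {i, j} else d v = c v"
    unfolding kempe_step_def by blast
  have "if d v \<in> {i, j} then c v \<in> {i, j} else c v = d v" if "v \<in> verts G" for v
    using bspec[OF ij that] by (auto split: if_splits)
  then show ?thesis using assms unfolding kempe_step_def by blast
qed

text \<open>Colourings of a complete graph are injective, and exchanging the colours \<open>c v\<close> and \<open>d v\<close> makes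
  \<open>v\<close> agree with the target without destroying any agreement.\<close>

lemma complete_graph_kempe_equivalent:
  assumes "complete_graph G" "finite (verts G)" "proper_colouring G k c" "proper_colouring G k d"
  shows "(kempe_step G k)\<^sup>*\<^sup>* c d"
  using assms(3)
proof (induction "card {v \<in> verts G. c v \<noteq> d v}" arbitrary: c rule: less_induct)
  case less
  have inj_c: "u = v" if "u \<in> verts G" "v \<in> verts G" "c u = c v" for u v
    using that less.prems assms(1) unfolding proper_colouring_def complete_graph_def by blast
  have inj_d: "u = v" if "u \<in> verts G" "v \<in> verts G" "d u = d v" for u v
    using that assms(1,4) unfolding proper_colouring_def complete_graph_def by blast
  show ?case
  proof (cases "\<exists>v \<in> verts G. c v \<noteq> d v")
    case False
    then show ?thesis using kempe_step_eqI[OF less.prems assms(4)] by auto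
  next
    case True
    then obtain v where v: "v \<in> verts G" "c v \<noteq> d v" by blast
    define c' where "c' u = (if c u = c v then d v else if c u = d v then c v else c u)" for u
    have "c u \<noteq> c w" if "u \<in> verts G" "w \<in> verts G" "adj G u w" for u w
      using that less.prems unfolding proper_colouring_def by blast
    moreover have "c' u \<noteq> c' w" if "u \<in> verts G" "w \<in> verts G" "adj G u w" for u w
    proof -
      have "c u \<noteq> c w" using that \<open>\<And>u w. \<lbrakk>u \<in> verts G; w \<in> verts G; adj G u w\<rbrakk> \<Longrightarrow> c u \<noteq> c w\<close> by blast
      then show ?thesis by (auto simp: c'_def)
    qed
    moreover have "c' u < k" if "u \<in> verts G" for u
      using that less.prems assms(4) v unfolding proper_colouring_def c'_def by auto
    ultimately have proper: "proper_colouring G k c'" unfolding proper_colouring_def by blast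
    have "\<forall>u \<in> verts G. if c u \<in> {c v, d v} then c' u \<in> {c v, d v} else c' u = c u"
      by (auto simp: c'_def)
    then have step: "kempe_step G k c c'"
      unfolding kempe_step_def using less.prems proper by blast
    have "{u \<in> verts G. c' u \<noteq> d u} \<subseteq> {u \<in> verts G. c u \<noteq> d u} - {v}"
    proof
      fix u assume u: "u \<in> {u \<in> verts G. c' u \<noteq> d u}"
      then have "u \<noteq> v" by (auto simp: c'_def)
      then have "c u \<noteq> c v" "d u \<noteq> d v" using inj_c inj_d u v(1) by blast+
      then show "u \<in> {u \<in> verts G. c u \<noteq> d u} - {v}"
        using u \<open>u \<noteq> v\<close> by (auto simp: c'_def)
    qed
    then have "card {u \<in> verts G. c' u \<noteq> d u} < card {u \<in> verts G. c u \<noteq> d u}"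
      using v assms(2) by (intro psubset_card_mono) auto
    from less.hyps[OF this proper] show ?thesis
      by (rule converse_rtranclp_into_rtranclp[of "kempe_step G k", OF step])
  qed
qed

text \<open>A shortest walk has no repetitions and no chords, since either would allow a shortcut.\<close>

lemma shortest_walk:
  assumes "R\<^sup>*\<^sup>* x y"
  obtains p where "p \<noteq> []" "hd p = x" "last p = y" "successively R p" "distinct p"
    "\<And>a b. \<lbrakk>a < b; b < length p; R (p ! a) (p ! b)\<rbrakk> \<Longrightarrow> b = Suc a"
proof -
  define walk where "walk p \<longleftrightarrow> p \<noteq> [] \<and> hd p = x \<and> last p = y \<and> successively R p" for p
  have "\<exists>p. p \<noteq> [] \<and> hd p = x \<and> last p = y \<and> successively R p"
    using assms
  proof (induction rule: rtranclp_induct)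
    case base
    then show ?case by (intro exI[of _ "[x]"]) simp
  next
    case (step y z)
    then obtain p where "p \<noteq> []" "hd p = x" "last p = y" "successively R p" by blast
    with step.hyps show ?case by (intro exI[of _ "p @ [z]"]) (simp add: successively_append_iff)
  qed
  then obtain p where p: "walk p" and min: "\<And>q. walk q \<Longrightarrow> length p \<le> length q"
    using ex_has_least_nat[of walk _ length] unfolding walk_def[symmetric] by metis
  have split: "successively R (take n p)" "successively R (drop n p)" for n
    using p append_take_drop_id[of n p] unfolding walk_def by (metis successively_append_iff)+
  have ne: "p ! a \<noteq> p ! b" if ab: "a < b" "b < length p" for a b
  proof
    assume eq: "p ! a = p ! b"
    \<comment> \<open>The case \<open>a = 0\<close> is special, as the shortcut then starts at \<open>p ! b\<close>.\<close>
    let ?q = "take a p @ drop b p"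
    have "hd ?q = x"
    proof (cases "a = 0")
      case True
      then have "hd ?q = p ! 0" using ab eq by (simp add: hd_drop_conv_nth)
      then show ?thesis using p hd_conv_nth[of p] by (simp add: walk_def)
    next
      case False
      then show ?thesis using p ab by (cases p) (auto simp: walk_def hd_append take_Cons')
    qed
    moreover have "take a p \<noteq> [] \<Longrightarrow> R (last (take a p)) (hd (drop b p))"
    proof -
      assume "take a p \<noteq> []"
      then have "0 < a" by auto
      then obtain m where "a = Suc m" by (cases a) auto
      then have "last (take a p) = p ! (a - 1)" using ab by (simp add: take_Suc_conv_app_nth)
      moreover have "R (p ! (a - 1)) (p ! a)"
        using p \<open>0 < a\<close> ab successively_nth[of R p "a - 1"] by (simp add: walk_def)
      ultimately show ?thesis using ab eq by (simp add: hd_drop_conv_nth)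
    qed
    ultimately have "walk ?q"
      using ab p split by (auto simp: walk_def successively_append_iff)
    from min[OF this] show False using ab by simp
  qed
  have "b = Suc a" if ab: "a < b" "b < length p" "R (p ! a) (p ! b)" for a b
  proof (rule ccontr)
    assume "b \<noteq> Suc a"
    let ?q = "take (Suc a) p @ drop b p"
    have "last (take (Suc a) p) = p ! a" using ab by (simp add: take_Suc_conv_app_nth)
    then have "walk ?q"
      using ab p split by (auto simp: walk_def successively_append_iff hd_drop_conv_nth)
    from min[OF this] show False using ab \<open>b \<noteq> Suc a\<close> by simp
  qed
  moreover have "distinct p"
    unfolding distinct_conv_nth using ne by (metis linorder_neqE_nat)
  ultimately show ?thesis using p by (intro that[of p]) (auto simp: walk_def)
qed

lemma edge_cases:
  assumes "simple_graph G" "e \<in> edges G"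
  obtains u v where "e = {u, v}" "u \<noteq> v" "u \<in> verts G" "v \<in> verts G" "adj G u v"
proof -
  from assms have "card e = 2" "e \<subseteq> verts G" by (auto simp: simple_graph_def)
  then obtain u v where "e = {u, v}" "u \<noteq> v" by (auto simp: card_2_iff)
  with that[of u v] assms(2) \<open>e \<subseteq> verts G\<close> show ?thesis by (simp add: adj_def)
qed

lemma adj_sym: "adj G u v \<longleftrightarrow> adj G v u"
  by (simp add: adj_def insert_commute)

lemma simple_graph_adjD: "simple_graph G \<Longrightarrow> adj G u v \<Longrightarrow> u \<in> verts G \<and> v \<in> verts G \<and> u \<noteq> v"
  unfolding simple_graph_def adj_def by fastforce

text \<open>Along a chordless walk in two colours the colours alternate, so its length is odd when the ends
  have different colours; a chord in \<open>G\<close> would again join vertices of the two colours.\<close>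

lemma two_colour_chain_induced_path:
  assumes G: "simple_graph G" and c: "proper_colouring G k c" and x: "x \<in> verts G" "c x = i"
    and y: "c y = j" and ij: "i \<noteq> j"
    and chain: "(\<lambda>u v. adj G u v \<and> c u \<in> {i, j} \<and> c v \<in> {i, j})\<^sup>*\<^sup>* x y"
  obtains p where "induced_path G p x y" "odd (length p - 1)"
proof -
  let ?R = "\<lambda>u v. adj G u v \<and> c u \<in> {i, j} \<and> c v \<in> {i, j}"
  from shortest_walk[OF chain] obtain p where
    p: "p \<noteq> []" "hd p = x" "last p = y" "successively ?R p" "distinct p"
    and chord: "\<And>a b. \<lbrakk>a < b; b < length p; ?R (p ! a) (p ! b)\<rbrakk> \<Longrightarrow> b = Suc a"
    by blast
  have step: "?R (p ! n) (p ! Suc n)" if "Suc n < length p" for n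
    using successively_nth[OF p(4)] that by blast
  have "p ! n \<in> verts G \<and> c (p ! n) = (if even n then i else j)" if "n < length p" for n
    using that
  proof (induction n)
    case 0
    then show ?case using p x by (simp add: hd_conv_nth)
  next
    case (Suc n)
    then have R: "?R (p ! n) (p ! Suc n)" using step by blast
    then have "c (p ! n) \<noteq> c (p ! Suc n)" "p ! Suc n \<in> verts G"
      using c simple_graph_adjD[OF G] unfolding proper_colouring_def by blast+
    then show ?case using Suc R by auto
  qed
  note col = this
  have "odd (length p - 1)"
    using col[of "length p - 1"] p y ij by (auto simp: last_conv_nth split: if_splits)
  moreover have "set p \<subseteq> verts G" using col by (auto simp: set_conv_nth)
  moreover have "edges (induced G (set p)) = path_edges p"
  proof
    show "path_edges p \<subseteq> edges (induced G (set p))"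
      using step by (auto simp: path_edges_def induced_def adj_def)
    show "edges (induced G (set p)) \<subseteq> path_edges p"
    proof
      fix e assume "e \<in> edges (induced G (set p))"
      then have e: "e \<in> edges G" "e \<subseteq> set p" by (auto simp: induced_def)
      from edge_cases[OF G e(1)] obtain u v where uv: "e = {u, v}" "u \<noteq> v" "adj G u v" by metis
      then obtain a b where ab: "a < length p" "b < length p" "u = p ! a" "v = p ! b"
        using e(2) by (auto simp: in_set_conv_nth)
      have "?R u v" "?R v u" using uv ab col[of a] col[of b] adj_sym[of G u v] by auto
      then have "b = Suc a \<or> a = Suc b"
        using chord[of a b] chord[of b a] ab uv(2) by (cases a b rule: linorder_cases) auto
      then show "e \<in> path_edges p"
        using ab uv(1) unfolding path_edges_def by (auto simp: insert_commute)
    qed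
  qed
  ultimately show ?thesis using that p unfolding induced_path_def by blast
qed

text \<open>Exchange the two colours on the chain of \<open>x\<close>. The chain cannot contain \<open>y\<close>, as it would yield an
  induced path of odd length between the vertices of an even pair.\<close>

lemma even_pair_same_colour:
  assumes G: "simple_graph G" and xy: "even_pair G x y" and c: "proper_colouring G k c"
  obtains d where "kempe_step G k c d" "proper_colouring G k d" "d x = d y"
proof -
  let ?i = "c x" and ?j = "c y"
  let ?R = "\<lambda>u v. adj G u v \<and> c u \<in> {?i, ?j} \<and> c v \<in> {?i, ?j}"
  have xv: "x \<in> verts G" "y \<in> verts G" using xy by (auto simp: even_pair_def)
  define C where "C = {v. ?R\<^sup>*\<^sup>* x v}"
  define d where "d v = (if v \<in> C then (if c v = ?i then ?j else ?i) else c v)" for v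
  have xC: "x \<in> C" by (simp add: C_def)
  have sep: "?i = ?j \<or> y \<notin> C"
  proof (rule ccontr)
    assume "\<not> (?i = ?j \<or> y \<notin> C)"
    then have "?R\<^sup>*\<^sup>* x y" "?i \<noteq> ?j" by (auto simp: C_def)
    then obtain p where "induced_path G p x y" "odd (length p - 1)"
      using two_colour_chain_induced_path[OF G c xv(1) refl refl, of y] by blast
    then show False using xy unfolding even_pair_def by blast
  qed
  have col: "c v \<in> {?i, ?j}" if "v \<in> C" for v
    using that unfolding C_def mem_Collect_eq by (induction rule: rtranclp_induct) auto
  have closed: "v \<in> C" if "u \<in> C" "adj G u v" "c v \<in> {?i, ?j}" for u v
  proof -
    have "?R u v" using that col by blast
    then show ?thesis
      using that(1) rtranclp.rtrancl_into_rtrancl[of ?R x u v] unfolding C_def by simp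
  qed
  have "proper_colouring G k d"
    unfolding proper_colouring_def
  proof (intro conjI ballI impI)
    fix v assume "v \<in> verts G"
    then show "d v < k" using c xv by (simp add: proper_colouring_def d_def)
  next
    fix u v assume uv: "u \<in> verts G" "v \<in> verts G" "adj G u v"
    then have "c u \<noteq> c v" using c by (simp add: proper_colouring_def)
    moreover have "adj G v u" using uv(3) adj_sym by metis
    ultimately show "d u \<noteq> d v"
      using closed[of u v] closed[of v u] uv(3) col[of u] col[of v]
      by (auto simp: d_def)
  qed
  moreover from this have "kempe_step G k c d"
  proof -
    have "\<forall>v \<in> verts G. if c v \<in> {?i, ?j} then d v \<in> {?i, ?j} else d v = c v"
      using col by (auto simp: d_def)
    then show ?thesis using c \<open>proper_colouring G k d\<close> unfolding kempe_step_def by blast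
  qed
  moreover have "d x = d y" using sep xC col[of y] by (auto simp: d_def)
  ultimately show ?thesis using that by blast
qed

lemma simple_graph_contract:
  assumes "simple_graph G" "z \<notin> verts G" "x \<in> verts G" "y \<in> verts G"
  shows "simple_graph (contract G x y z)"
  using assms unfolding simple_graph_def contract_def
  by (auto simp: card_insert_if)

lemma verts_contract: "verts (contract G x y z) = insert z (verts G - {x, y})"
  by (simp add: contract_def)

definition uncontract :: "'a \<Rightarrow> 'a \<Rightarrow> 'a \<Rightarrow> ('a \<Rightarrow> nat) \<Rightarrow> 'a \<Rightarrow> nat" where
  "uncontract x y z c = (\<lambda>v. if v = x \<or> v = y then c z else c v)"

lemma proper_colouring_uncontract:
  assumes G: "simple_graph G" and xy: "\<not> adj G x y"
    and c: "proper_colouring (contract G x y z) k c"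
  shows "proper_colouring G k (uncontract x y z c)"
  unfolding proper_colouring_def
proof (intro conjI ballI impI)
  fix v assume "v \<in> verts G"
  then show "uncontract x y z c v < k"
    using c by (auto simp: uncontract_def proper_colouring_def contract_def)
next
  fix u v assume uv: "u \<in> verts G" "v \<in> verts G" "adj G u v"
  have c': "c a \<noteq> c b" if "a \<in> insert z (verts G - {x, y})" "b \<in> insert z (verts G - {x, y})"
      "{a, b} \<in> edges (contract G x y z)" for a b
    using that c unfolding proper_colouring_def by (metis adj_def verts_contract)
  have ne: "u \<noteq> v" using simple_graph_adjD[OF G uv(3)] by blast
  have old: "{u, v} \<in> edges (contract G x y z)" if "u \<notin> {x, y}" "v \<notin> {x, y}"
    using that uv by (auto simp: contract_def adj_def)
  have new: "{z, v} \<in> edges (contract G x y z)" if "u \<in> {x, y}" "v \<notin> {x, y}"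
    using that uv by (auto simp: contract_def)
  have new': "{z, u} \<in> edges (contract G x y z)" if "v \<in> {x, y}" "u \<notin> {x, y}"
    using that uv by (auto simp: contract_def adj_sym)
  have "\<not> (u \<in> {x, y} \<and> v \<in> {x, y})" using xy ne uv(3) adj_sym[of G x y] by auto
  then consider "u \<notin> {x, y}" "v \<notin> {x, y}" | "u \<in> {x, y}" "v \<notin> {x, y}" | "v \<in> {x, y}" "u \<notin> {x, y}" by blast
  then show "uncontract x y z c u \<noteq> uncontract x y z c v"
  proof cases
    case 1
    then show ?thesis using c'[of u v] old uv by (auto simp: uncontract_def)
  next
    case 2
    then show ?thesis using c'[of z v] new uv by (auto simp: uncontract_def)
  next
    case 3
    then show ?thesis using c'[of z u] new' uv by (auto simp: uncontract_def)
  qed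
qed

lemma kempe_step_uncontract:
  assumes "simple_graph G" "\<not> adj G x y" "kempe_step (contract G x y z) k c d"
  shows "kempe_step G k (uncontract x y z c) (uncontract x y z d)"
proof -
  from assms(3) obtain i j where
    "\<forall>v \<in> insert z (verts G - {x, y}). if c v \<in> {i, j} then d v \<in> {i, j} else d v = c v"
    unfolding kempe_step_def verts_contract by blast
  then have ij: "if c v \<in> {i, j} then d v \<in> {i, j} else d v = c v"
    if "v = z \<or> v \<in> verts G - {x, y}" for v using that by blast
  have "if uncontract x y z c v \<in> {i, j} then uncontract x y z d v \<in> {i, j}
      else uncontract x y z d v = uncontract x y z c v" if "v \<in> verts G" for v
    unfolding uncontract_def using ij[of z] ij[of v] that
    by (cases "v = x \<or> v = y") (auto split: if_splits)
  then show ?thesis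
    using assms proper_colouring_uncontract[OF assms(1,2)] unfolding kempe_step_def by blast
qed

lemma proper_colouring_contract:
  assumes G: "simple_graph G" and z: "z \<notin> verts G" and x: "x \<in> verts G" "y \<in> verts G"
    and c: "proper_colouring G k c" "c x = c y"
  shows "proper_colouring (contract G x y z) k (c(z := c x))"
  unfolding proper_colouring_def
proof (intro conjI ballI impI)
  fix v assume "v \<in> verts (contract G x y z)"
  then show "(c(z := c x)) v < k"
    using c x by (auto simp: proper_colouring_def contract_def)
next
  fix u v assume "adj (contract G x y z) u v"
  then consider "adj G u v" | w where "w \<in> verts G" "{u, v} = {z, w}" "adj G x w \<or> adj G y w"
    by (auto simp: adj_def contract_def)
  then show "(c(z := c x)) u \<noteq> (c(z := c x)) v"
  proof cases
    case 1
    then show ?thesis using simple_graph_adjD[OF G 1] z c by (auto simp: proper_colouring_def)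
  next
    case 2
    then have "c x \<noteq> c w" using c x by (auto simp: proper_colouring_def)
    then show ?thesis using 2 z by (auto simp: doubleton_eq_iff)
  qed
qed

text \<open>Bertschi's theorem, by induction along the contractions: both colourings are first moved to
  colourings with equal colours on the even pair; these come from the contracted graph, whose
  Kempe steps lift.\<close>

theorem even_contractile_kempe_equivalent:
  assumes "even_contractile G" "simple_graph G" "proper_colouring G k c" "proper_colouring G k d"
  shows "(kempe_step G k)\<^sup>*\<^sup>* c d"
proof -
  from assms(1) obtain H where "even_contraction\<^sup>*\<^sup>* G H" and H: "complete_graph H"
    unfolding even_contractile_def by blast
  from this(1) assms(2-4) show ?thesis
  proof (induction arbitrary: c d rule: converse_rtranclp_induct)
    case base
    then show ?case using complete_graph_kempe_equivalent[OF H] by (simp add: simple_graph_def)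
  next
    case (step G G')
    from step.hyps(1) obtain x y z where xy: "even_pair G x y" and z: "z \<notin> verts G"
      and G': "G' = contract G x y z" unfolding even_contraction_def by blast
    have v: "x \<in> verts G" "y \<in> verts G" "\<not> adj G x y" using xy by (auto simp: even_pair_def)
    note G = step.prems(1)
    have to_contract: "\<exists>e. kempe_step G k c e \<and> kempe_step G k e c \<and> e x = e y \<and> proper_colouring G k e"
      if c: "proper_colouring G k c" for c
    proof -
      obtain e where e: "kempe_step G k c e" "proper_colouring G k e" "e x = e y"
        using even_pair_same_colour[OF G xy c] by blast
      then show ?thesis using kempe_step_sym by blast
    qed
    obtain c1 where c1: "kempe_step G k c c1" "c1 x = c1 y" "proper_colouring G k c1"
      using to_contract step.prems by blast
    obtain d1 where d1: "kempe_step G k d1 d" "d1 x = d1 y" "proper_colouring G k d1"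
      using to_contract step.prems by blast
    let ?L = "uncontract x y z"
    have restrict: "kempe_step G k e (?L (e(z := e x))) \<and> kempe_step G k (?L (e(z := e x))) e"
      if "proper_colouring G k e" "e x = e y" for e
    proof -
      have "proper_colouring G k (?L (e(z := e x)))"
        using proper_colouring_uncontract[OF G v(3)] proper_colouring_contract[OF G z v(1,2)] that by blast
      moreover have "?L (e(z := e x)) u = e u" if "u \<in> verts G" for u
        using that z \<open>e x = e y\<close> by (auto simp: uncontract_def)
      ultimately show ?thesis using that kempe_step_sym
        by (auto intro!: kempe_step_eqI)
    qed
    have "(kempe_step G' k)\<^sup>*\<^sup>* (c1(z := c1 x)) (d1(z := d1 x))"
      unfolding G'
      by (rule step.IH[unfolded G', OF simple_graph_contract[OF G z v(1,2)]
            proper_colouring_contract[OF G z v(1,2) c1(3,2)]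
            proper_colouring_contract[OF G z v(1,2) d1(3,2)]])
    then have "(kempe_step G k)\<^sup>*\<^sup>* (?L (c1(z := c1 x))) (?L (d1(z := d1 x)))"
      unfolding G'
    proof (induction rule: rtranclp_induct)
      case (step e f)
      show ?case
        by (rule rtranclp.rtrancl_into_rtrancl[of "kempe_step G k", OF step.IH kempe_step_uncontract[OF G v(3) step.hyps(2)]])
    qed simp
    note middle = this
    have "(kempe_step G k)\<^sup>*\<^sup>* c (?L (c1(z := c1 x)))"
      using rtranclp.rtrancl_into_rtrancl[of "kempe_step G k", OF r_into_rtranclp[of "kempe_step G k", OF c1(1)]]
        restrict[OF c1(3,2)] by blast
    moreover have "(kempe_step G k)\<^sup>*\<^sup>* (?L (d1(z := d1 x))) d"
      using rtranclp.rtrancl_into_rtrancl[of "kempe_step G k", OF r_into_rtranclp[of "kempe_step G k"] d1(1)]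
        restrict[OF d1(3,2)] by blast
    ultimately show ?case using middle by (meson rtranclp_trans)
  qed
qed

section \<open>Colourings of replications as monomials\<close>

text \<open>The product of the variables of the \<open>k\<close> colour classes, projected along \<open>\<pi>\<close>. Empty classes count:
  they contribute the variable of the empty stable set, so the degree is always \<open>k\<close>.\<close>

definition colouring_monomial :: "nat \<Rightarrow> 'b set \<Rightarrow> ('b \<Rightarrow> 'a) \<Rightarrow> ('b \<Rightarrow> nat) \<Rightarrow> 'a set \<Rightarrow>\<^sub>0 nat" where
  "colouring_monomial k W \<pi> c = (\<Sum>i<k. Poly_Mapping.single (\<pi> ` {v \<in> W. c v = i}) 1)"

text \<open>The fibres of \<open>\<pi>\<close> are the cliques that replace the vertices of \<open>G\<close>; a fibre may be empty.\<close>

definition is_replication :: "'b graph \<Rightarrow> 'a graph \<Rightarrow> ('b \<Rightarrow> 'a) \<Rightarrow> bool" where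
  "is_replication H G \<pi> \<longleftrightarrow> simple_graph H \<and> \<pi> ` verts H \<subseteq> verts G \<and>
     (\<forall>u \<in> verts H. \<forall>v \<in> verts H. adj H u v \<longleftrightarrow> u \<noteq> v \<and> (\<pi> u = \<pi> v \<or> adj G (\<pi> u) (\<pi> v)))"

lemma colour_class_replication:
  assumes G: "simple_graph G" and H: "is_replication H G \<pi>" and c: "proper_colouring H k c"
  shows "inj_on \<pi> {v \<in> verts H. c v = i}" "\<pi> ` {v \<in> verts H. c v = i} \<in> stable_sets G"
proof -
  have same: "\<not> adj G (\<pi> u) (\<pi> v) \<and> (\<pi> u = \<pi> v \<longrightarrow> u = v)"
    if "u \<in> verts H" "v \<in> verts H" "c u = c v" for u v
  proof (cases "u = v")
    case True
    then show ?thesis using simple_graph_adjD[OF G] by blast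
  next
    case False
    then show ?thesis using that H c unfolding is_replication_def proper_colouring_def by blast
  qed
  then show "inj_on \<pi> {v \<in> verts H. c v = i}" by (auto simp: inj_on_def)
  show "\<pi> ` {v \<in> verts H. c v = i} \<in> stable_sets G"
    using same H by (auto simp: stable_sets_def is_replication_def)
qed

lemma set_exponent_image:
  "inj_on \<pi> C \<Longrightarrow> set_exponent (\<pi> ` C) =
     Poly_Mapping.single Svar 1 + (\<Sum>v \<in> C. Poly_Mapping.single (Tvar (\<pi> v)) 1)"
  by (simp add: set_exponent_def sum.reindex)

text \<open>All classes but two are unchanged, so the binomial is a monomial multiple of the quadratic one
  formed by the two recoloured classes.\<close>

lemma kempe_step_binomial:
  fixes J :: "('a set, 'k::field) mpoly set"
  assumes G: "simple_graph G" and H: "is_replication H G \<pi>"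
    and J: "ideal J (poly_ring (stable_sets G))"
    and quadratic: "\<And>S S' T T'. \<lbrakk>{S, S', T, T'} \<subseteq> stable_sets G;
        set_exponent S + set_exponent S' = set_exponent T + set_exponent T'\<rbrakk> \<Longrightarrow>
        Poly_Mapping.single (Poly_Mapping.single S 1 + Poly_Mapping.single S' 1) 1
          - Poly_Mapping.single (Poly_Mapping.single T 1 + Poly_Mapping.single T' 1) 1 \<in> J"
    and step: "kempe_step H k c d"
  shows "Poly_Mapping.single (colouring_monomial k (verts H) \<pi> c) 1
     - Poly_Mapping.single (colouring_monomial k (verts H) \<pi> d) 1 \<in> J"
proof -
  interpret J: ideal J "poly_ring (stable_sets G)" by (rule J)
  have c: "proper_colouring H k c" and d: "proper_colouring H k d"
    using step by (auto simp: kempe_step_def)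
  obtain i j where ij: "\<And>v. v \<in> verts H \<Longrightarrow> if c v \<in> {i, j} then d v \<in> {i, j} else d v = c v"
    using step unfolding kempe_step_def by blast
  define C where "C e l = {v \<in> verts H. e v = l}" for e :: "'b \<Rightarrow> nat" and l
  have fin: "finite (C e l)" for e l
    using H by (simp add: C_def is_replication_def simple_graph_def)
  have other: "C c l = C d l" if "l \<notin> {i, j}" for l
    using ij that by (fastforce simp: C_def split: if_splits)
  have M: "colouring_monomial k (verts H) \<pi> e = (\<Sum>l<k. Poly_Mapping.single (\<pi> ` C e l) 1)" for e
    by (simp add: colouring_monomial_def C_def)
  show ?thesis
  \<comment> \<open>A step whose two colours coincide or are not both below \<open>k\<close> changes nothing.\<close>
  proof (cases "i < k \<and> j < k \<and> i \<noteq> j")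
    case False
    have "c v = d v" if "v \<in> verts H" for v
    proof -
      have "c v < k" "d v < k" using that c d by (auto simp: proper_colouring_def)
      then show ?thesis using ij[OF that] False by (auto split: if_splits)
    qed
    then have "C c l = C d l" for l by (auto simp: C_def)
    then show ?thesis
      using additive_subgroup.zero_closed[OF J.is_additive_subgroup] by (simp add: M poly_ring_def)
  next
    case True
    define r where "r = (\<Sum>l \<in> {..<k} - {i, j}. Poly_Mapping.single (\<pi> ` C c l) (1::nat))"
    have split: "(\<Sum>l<k. f l) = (\<Sum>l \<in> {..<k} - {i, j}. f l) + (f i + f j)" for f :: "nat \<Rightarrow> 'a set \<Rightarrow>\<^sub>0 nat"
      using True sum.subset_diff[of "{i, j}" "{..<k}" f] by simp
    have Mc: "colouring_monomial k (verts H) \<pi> c =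
        r + (Poly_Mapping.single (\<pi> ` C c i) 1 + Poly_Mapping.single (\<pi> ` C c j) 1)"
      unfolding M split r_def ..
    have "r = (\<Sum>l \<in> {..<k} - {i, j}. Poly_Mapping.single (\<pi> ` C d l) 1)"
      unfolding r_def by (rule sum.cong) (use other in auto)
    then have Md: "colouring_monomial k (verts H) \<pi> d =
        r + (Poly_Mapping.single (\<pi> ` C d i) 1 + Poly_Mapping.single (\<pi> ` C d j) 1)"
      unfolding M split by simp
    have union: "set_exponent (\<pi> ` C e i) + set_exponent (\<pi> ` C e j) =
        Poly_Mapping.single Svar 1 + Poly_Mapping.single Svar 1 +
        (\<Sum>v \<in> C e i \<union> C e j. Poly_Mapping.single (Tvar (\<pi> v)) 1)"
      if e: "proper_colouring H k e" for e
    proof -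
      have "C e i \<inter> C e j = {}" using True by (auto simp: C_def)
      then have "(\<Sum>v \<in> C e i \<union> C e j. Poly_Mapping.single (Tvar (\<pi> v)) (1::nat)) =
          (\<Sum>v \<in> C e i. Poly_Mapping.single (Tvar (\<pi> v)) 1) + (\<Sum>v \<in> C e j. Poly_Mapping.single (Tvar (\<pi> v)) 1)"
        by (rule sum.union_disjoint[OF fin fin])
      moreover have "inj_on \<pi> (C e l)" for l
        using colour_class_replication(1)[OF G H e] by (simp add: C_def)
      ultimately show ?thesis by (simp only: set_exponent_image ac_simps)
    qed
    have "C c i \<union> C c j = C d i \<union> C d j"
      using ij by (fastforce simp: C_def split: if_splits)
    then have "set_exponent (\<pi> ` C c i) + set_exponent (\<pi> ` C c j)
        = set_exponent (\<pi> ` C d i) + set_exponent (\<pi> ` C d j)"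
      using union[OF c] union[OF d] by simp
    moreover have st: "\<pi> ` C e l \<in> stable_sets G" if "proper_colouring H k e" for e l
      using colour_class_replication(2)[OF G H that] by (simp add: C_def)
    ultimately have "Poly_Mapping.single (Poly_Mapping.single (\<pi> ` C c i) 1 + Poly_Mapping.single (\<pi> ` C c j) 1) 1
          - Poly_Mapping.single (Poly_Mapping.single (\<pi> ` C d i) 1 + Poly_Mapping.single (\<pi> ` C d j) 1) 1 \<in> J"
      using c d by (intro quadratic) auto
    moreover have "Poly_Mapping.single r 1 \<in> carrier (poly_ring (stable_sets G))"
    proof -
      have "Poly_Mapping.keys r \<subseteq> (\<Union>l \<in> {..<k} - {i, j}. Poly_Mapping.keys (Poly_Mapping.single (\<pi> ` C c l) (1::nat)))"
        unfolding r_def by (rule keys_sum)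
      also have "\<dots> \<subseteq> stable_sets G" using st[OF c] by auto
      finally show ?thesis by (simp add: poly_ring_def)
    qed
    ultimately have "Poly_Mapping.single r 1 *
        (Poly_Mapping.single (Poly_Mapping.single (\<pi> ` C c i) 1 + Poly_Mapping.single (\<pi> ` C c j) 1) 1
          - Poly_Mapping.single (Poly_Mapping.single (\<pi> ` C d i) 1 + Poly_Mapping.single (\<pi> ` C d j) 1) 1) \<in> J"
      using J.I_l_closed by (simp add: poly_ring_def)
    then show ?thesis by (simp add: Mc Md right_diff_distrib mult_single)
  qed
qed

lemma kempe_equivalent_binomial:
  fixes J :: "('a set, 'k::field) mpoly set"
  assumes G: "simple_graph G" and H: "is_replication H G \<pi>"
    and J: "ideal J (poly_ring (stable_sets G))"
    and quadratic: "\<And>S S' T T'. \<lbrakk>{S, S', T, T'} \<subseteq> stable_sets G;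
        set_exponent S + set_exponent S' = set_exponent T + set_exponent T'\<rbrakk> \<Longrightarrow>
        Poly_Mapping.single (Poly_Mapping.single S 1 + Poly_Mapping.single S' 1) 1
          - Poly_Mapping.single (Poly_Mapping.single T 1 + Poly_Mapping.single T' 1) 1 \<in> J"
    and equiv: "(kempe_step H k)\<^sup>*\<^sup>* c d"
  shows "Poly_Mapping.single (colouring_monomial k (verts H) \<pi> c) 1
     - Poly_Mapping.single (colouring_monomial k (verts H) \<pi> d) 1 \<in> J"
  using equiv
proof (induction rule: rtranclp_induct)
  interpret J: ideal J "poly_ring (stable_sets G)" by (rule J)
  case base
  then show ?case
    using additive_subgroup.zero_closed[OF J.is_additive_subgroup] by (simp add: poly_ring_def)
next
  interpret J: ideal J "poly_ring (stable_sets G)" by (rule J)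
  case (step d e)
  show ?case
    using additive_subgroup.a_closed[OF J.is_additive_subgroup step.IH
        kempe_step_binomial[OF G H J quadratic step.hyps(2)]]
    by (simp add: poly_ring_def)
qed

lemma monomial_as_list:
  fixes u :: "'a \<Rightarrow>\<^sub>0 nat"
  obtains As where "set As \<subseteq> Poly_Mapping.keys u" "u = (\<Sum>i<length As. Poly_Mapping.single (As ! i) 1)"
proof -
  have rep: "sum_list (replicate n (Poly_Mapping.single x 1)) = Poly_Mapping.single x n"
    for x :: 'a and n :: nat
    by (induction n) (simp_all add: single_add[symmetric])
  have "\<exists>As. set As \<subseteq> I \<and> sum_list (map (\<lambda>A. Poly_Mapping.single A 1) As) =
       (\<Sum>A \<in> I. Poly_Mapping.single A (n A))" if "finite I" for I :: "'a set" and n :: "'a \<Rightarrow> nat"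
    using that
  proof (induction I rule: finite_induct)
    case (insert x I)
    then obtain As where "set As \<subseteq> I"
      "sum_list (map (\<lambda>A. Poly_Mapping.single A 1) As) = (\<Sum>A \<in> I. Poly_Mapping.single A (n A))"
      by blast
    then show ?case using insert.hyps rep[of "n x" x]
      by (intro exI[of _ "replicate (n x) x @ As"]) (auto simp: map_replicate)
  qed simp
  from this[OF finite_keys, of u "Poly_Mapping.lookup u"] obtain As where
    As: "set As \<subseteq> Poly_Mapping.keys u" and
    "sum_list (map (\<lambda>A. Poly_Mapping.single A 1) As) = u"
    unfolding poly_mapping_sum_single[symmetric] by blast
  moreover have "sum_list (map (\<lambda>A. Poly_Mapping.single A (1::nat)) As) =
      (\<Sum>i<length As. Poly_Mapping.single (As ! i) 1)"
    by (simp add: sum_list_sum_nth atLeast0LessThan)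
  ultimately show ?thesis by (intro that[OF As]) simp
qed

lemma lookup_set_exponent:
  "Poly_Mapping.lookup (set_exponent A) Svar = 1"
  "finite A \<Longrightarrow> Poly_Mapping.lookup (set_exponent A) (Tvar v) = (if v \<in> A then 1 else 0)"
  by (simp_all add: set_exponent_def lookup_add lookup_sum lookup_single when_def)

lemma finite_stable_set: "simple_graph G \<Longrightarrow> A \<in> stable_sets G \<Longrightarrow> finite A"
  by (auto simp: simple_graph_def stable_sets_def intro: finite_subset)

lemma lookup_sum_set_exponent:
  "Poly_Mapping.lookup (\<Sum>i \<in> I. set_exponent (A i)) Svar = card I"
  "\<lbrakk>finite I; \<forall>i \<in> I. finite (A i)\<rbrakk> \<Longrightarrow>
     Poly_Mapping.lookup (\<Sum>i \<in> I. set_exponent (A i)) (Tvar v) = card {i \<in> I. v \<in> A i}"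
proof -
  show "Poly_Mapping.lookup (\<Sum>i \<in> I. set_exponent (A i)) Svar = card I"
    by (simp add: lookup_sum lookup_set_exponent)
  assume I: "finite I" "\<forall>i \<in> I. finite (A i)"
  have "Poly_Mapping.lookup (\<Sum>i \<in> I. set_exponent (A i)) (Tvar v) = (\<Sum>i \<in> I. if v \<in> A i then 1 else 0)"
    unfolding lookup_sum by (rule sum.cong) (use I(2) in \<open>simp_all add: lookup_set_exponent(2)\<close>)
  then show "Poly_Mapping.lookup (\<Sum>i \<in> I. set_exponent (A i)) (Tvar v) = card {i \<in> I. v \<in> A i}"
    using I(1) by (simp add: sum.If_cases Int_def)
qed

text \<open>Two families of sets have the same image when they have the same size and cover every vertex
  equally often.\<close>

lemma sum_set_exponent_eq_iff:
  fixes A :: "'i \<Rightarrow> 'a set" and B :: "'j \<Rightarrow> 'a set"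
  assumes I: "finite I" "\<forall>i \<in> I. finite (A i)" and J: "finite J" "\<forall>j \<in> J. finite (B j)"
  shows "(\<Sum>i \<in> I. set_exponent (A i)) = (\<Sum>j \<in> J. set_exponent (B j)) \<longleftrightarrow>
    card I = card J \<and> (\<forall>v. card {i \<in> I. v \<in> A i} = card {j \<in> J. v \<in> B j})"
proof
  assume eq: "(\<Sum>i \<in> I. set_exponent (A i)) = (\<Sum>j \<in> J. set_exponent (B j))"
  show "card I = card J \<and> (\<forall>v. card {i \<in> I. v \<in> A i} = card {j \<in> J. v \<in> B j})"
  proof (intro conjI allI)
    show "card I = card J"
      using arg_cong[OF eq, of "\<lambda>e. Poly_Mapping.lookup e Svar"]
      unfolding lookup_sum_set_exponent(1) .
    fix v
    show "card {i \<in> I. v \<in> A i} = card {j \<in> J. v \<in> B j}"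
      using arg_cong[OF eq, of "\<lambda>e. Poly_Mapping.lookup e (Tvar v)"]
      unfolding lookup_sum_set_exponent(2)[OF I] lookup_sum_set_exponent(2)[OF J] .
  qed
next
  assume r: "card I = card J \<and> (\<forall>v. card {i \<in> I. v \<in> A i} = card {j \<in> J. v \<in> B j})"
  show "(\<Sum>i \<in> I. set_exponent (A i)) = (\<Sum>j \<in> J. set_exponent (B j))"
  proof (rule poly_mapping_eqI)
    fix x :: "'a tsvar"
    show "Poly_Mapping.lookup (\<Sum>i \<in> I. set_exponent (A i)) x = Poly_Mapping.lookup (\<Sum>j \<in> J. set_exponent (B j)) x"
      by (cases x) (simp_all add: r lookup_sum_set_exponent(1) lookup_sum_set_exponent(2)[OF I]
          lookup_sum_set_exponent(2)[OF J])
  qed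
qed

text \<open>List the factors of \<open>u\<close> and \<open>w\<close> as stable sets \<open>A\<^sub>i\<close> and \<open>B\<^sub>i\<close> with \<open>i < k\<close>. The vertices of the
  replication are the incidences \<open>(i, v)\<close> with \<open>v \<in> A\<^sub>i\<close>, numbered by an enumeration \<open>h\<close>, and \<open>c\<close>
  is the first component. As \<open>v\<close> lies in equally many sets on both sides, a bijection \<open>\<sigma> v\<close> turns
  the incidences of \<open>v\<close> with the \<open>A\<^sub>i\<close> into those with the \<open>B\<^sub>i\<close>, which gives \<open>d\<close>.\<close>

lemma monomials_as_colourings:
  fixes G :: "'a graph"
  assumes G: "simple_graph G"
    and u: "Poly_Mapping.keys u \<subseteq> stable_sets G" and w: "Poly_Mapping.keys w \<subseteq> stable_sets G"
    and image: "image_exponent u = image_exponent w"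
  obtains H :: "nat graph" and \<pi> k c d where "is_replication H G \<pi>"
    "proper_colouring H k c" "proper_colouring H k d"
    "colouring_monomial k (verts H) \<pi> c = u" "colouring_monomial k (verts H) \<pi> d = w"
proof -
  obtain As where As: "set As \<subseteq> Poly_Mapping.keys u" "u = (\<Sum>i<length As. Poly_Mapping.single (As ! i) 1)"
    by (rule monomial_as_list)
  obtain Bs where Bs: "set Bs \<subseteq> Poly_Mapping.keys w" "w = (\<Sum>i<length Bs. Poly_Mapping.single (Bs ! i) 1)"
    by (rule monomial_as_list)
  define k where "k = length As"
  have A: "As ! i \<in> stable_sets G" if "i < length As" for i using that As(1) u nth_mem by blast
  have B: "Bs ! i \<in> stable_sets G" if "i < length Bs" for i using that Bs(1) w nth_mem by blast
  have "(\<Sum>i<length As. set_exponent (As ! i)) = (\<Sum>i<length Bs. set_exponent (Bs ! i))"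
    using image unfolding As(2) Bs(2) by (simp add: image_exponent_sum)
  moreover have "(\<Sum>i<length As. set_exponent (As ! i)) = (\<Sum>i<length Bs. set_exponent (Bs ! i)) \<longleftrightarrow>
      card {..<length As} = card {..<length Bs} \<and>
      (\<forall>v. card {i \<in> {..<length As}. v \<in> As ! i} = card {i \<in> {..<length Bs}. v \<in> Bs ! i})"
    by (rule sum_set_exponent_eq_iff) (auto intro: A B finite_stable_set[OF G])
  ultimately have eq: "card {..<length As} = card {..<length Bs}"
    "\<forall>v. card {i \<in> {..<length As}. v \<in> As ! i} = card {i \<in> {..<length Bs}. v \<in> Bs ! i}"
    by blast+
  from eq(1) have len: "length Bs = k" by (simp add: k_def)
  have cnt: "card {i. i < k \<and> v \<in> As ! i} = card {i. i < k \<and> v \<in> Bs ! i}" for v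
    using spec[OF eq(2), of v] unfolding k_def[symmetric] len by simp
  have "\<exists>\<sigma>. bij_betw \<sigma> {i. i < k \<and> v \<in> As ! i} {i. i < k \<and> v \<in> Bs ! i}" for v
    by (rule finite_same_card_bij) (use cnt in auto)
  then obtain \<sigma> where \<sigma>: "\<And>v. bij_betw (\<sigma> v) {i. i < k \<and> v \<in> As ! i} {i. i < k \<and> v \<in> Bs ! i}"
    by metis
  define W where "W = Sigma {..<k} (\<lambda>i. As ! i)"
  have finW: "finite W" unfolding W_def using A finite_stable_set[OF G] by (auto simp: k_def)
  then obtain h where h: "bij_betw h {0..<card W} W" using ex_bij_betw_nat_finite by blast
  have hW: "h ` {0..<card W} = W" and hinj: "inj_on h {0..<card W}" using h by (auto simp: bij_betw_def)
  define \<pi> where "\<pi> m = snd (h m)" for m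
  define c where "c m = fst (h m)" for m
  define d where "d m = \<sigma> (snd (h m)) (fst (h m))" for m
  define H where "H = \<lparr>verts = {0..<card W},
     edges = {{m, n} | m n. m < card W \<and> n < card W \<and> m \<noteq> n \<and> (\<pi> m = \<pi> n \<or> adj G (\<pi> m) (\<pi> n))}\<rparr>"
  have vH: "verts H = {0..<card W}" by (simp add: H_def)
  have adjH: "adj H m n \<longleftrightarrow> m \<noteq> n \<and> (\<pi> m = \<pi> n \<or> adj G (\<pi> m) (\<pi> n))"
    if "m \<in> verts H" "n \<in> verts H" for m n
    using that adj_sym[of G] by (auto simp: H_def adj_def doubleton_eq_iff insert_commute)
  have mem: "c m < k \<and> \<pi> m \<in> As ! c m" if "m \<in> verts H" for m
  proof -
    have "h m \<in> W" using that hW vH by blast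
    then show ?thesis unfolding W_def c_def \<pi>_def by auto
  qed
  have dmem: "d m < k \<and> \<pi> m \<in> Bs ! d m" if "m \<in> verts H" for m
    using bij_betw_apply[OF \<sigma>[of "\<pi> m"], of "c m"] mem[OF that] by (simp add: d_def \<pi>_def c_def)
  have eqI: "m = n" if "m \<in> verts H" "n \<in> verts H" "c m = c n" "\<pi> m = \<pi> n" for m n
    using that hinj by (simp add: vH c_def \<pi>_def inj_on_def prod_eq_iff)
  have deqI: "m = n" if "m \<in> verts H" "n \<in> verts H" "d m = d n" "\<pi> m = \<pi> n" for m n
  proof -
    have "\<sigma> (\<pi> m) (c m) = \<sigma> (\<pi> m) (c n)" using that by (simp add: d_def c_def \<pi>_def)
    then have "c m = c n"
      using \<sigma>[of "\<pi> m"] mem[of m] mem[of n] that unfolding bij_betw_def inj_on_def by auto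
    then show ?thesis using eqI that by blast
  qed
  have "is_replication H G \<pi>"
    unfolding is_replication_def
  proof (intro conjI ballI)
    show "simple_graph H" by (auto simp: simple_graph_def H_def)
    show "\<pi> ` verts H \<subseteq> verts G"
      using mem A by (fastforce simp: k_def stable_sets_def)
  qed (rule adjH)
  moreover have "proper_colouring H k c"
    unfolding proper_colouring_def
  proof (intro conjI ballI impI notI)
    fix m n assume mn: "m \<in> verts H" "n \<in> verts H" "adj H m n" "c m = c n"
    then have "m \<noteq> n" "\<pi> m = \<pi> n \<or> adj G (\<pi> m) (\<pi> n)" using adjH by auto
    moreover have "\<not> adj G (\<pi> m) (\<pi> n)"
      using mem[OF mn(1)] mem[OF mn(2)] mn(4) A[of "c m"] by (simp add: stable_sets_def k_def)
    ultimately show False using eqI mn by blast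
  qed (use mem in blast)
  moreover have "proper_colouring H k d"
    unfolding proper_colouring_def
  proof (intro conjI ballI impI notI)
    fix m n assume mn: "m \<in> verts H" "n \<in> verts H" "adj H m n" "d m = d n"
    then have "m \<noteq> n" "\<pi> m = \<pi> n \<or> adj G (\<pi> m) (\<pi> n)" using adjH by auto
    moreover have "\<not> adj G (\<pi> m) (\<pi> n)"
      using dmem[OF mn(1)] dmem[OF mn(2)] mn(4) B[of "d m"] by (simp add: stable_sets_def len)
    ultimately show False using deqI mn by blast
  qed (use dmem in blast)
  moreover have "\<pi> ` {m \<in> verts H. c m = i} = As ! i" if "i < k" for i
  proof
    show "\<pi> ` {m \<in> verts H. c m = i} \<subseteq> As ! i" using mem by auto
    show "As ! i \<subseteq> \<pi> ` {m \<in> verts H. c m = i}"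
    proof
      fix v assume "v \<in> As ! i"
      then have "(i, v) \<in> W" using that by (simp add: W_def)
      then obtain m where "m \<in> verts H" "h m = (i, v)" using hW vH by (metis imageE)
      then show "v \<in> \<pi> ` {m \<in> verts H. c m = i}" by (force simp: c_def \<pi>_def)
    qed
  qed
  then have "colouring_monomial k (verts H) \<pi> c = u"
    unfolding colouring_monomial_def As(2) k_def[symmetric] by simp
  moreover have "\<pi> ` {m \<in> verts H. d m = i} = Bs ! i" if "i < k" for i
  proof
    show "\<pi> ` {m \<in> verts H. d m = i} \<subseteq> Bs ! i" using dmem by auto
    show "Bs ! i \<subseteq> \<pi> ` {m \<in> verts H. d m = i}"
    proof
      fix v assume "v \<in> Bs ! i"
      then have "i \<in> \<sigma> v ` {i. i < k \<and> v \<in> As ! i}"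
        using \<sigma>[of v] that by (simp add: bij_betw_def)
      then obtain l where l: "l < k" "v \<in> As ! l" "\<sigma> v l = i" by blast
      then have "(l, v) \<in> W" by (simp add: W_def)
      then obtain m where "m \<in> verts H" "h m = (l, v)" using hW vH by (metis imageE)
      then show "v \<in> \<pi> ` {m \<in> verts H. d m = i}" using l by (force simp: d_def \<pi>_def)
    qed
  qed
  then have "colouring_monomial k (verts H) \<pi> d = w"
    unfolding colouring_monomial_def Bs(2) len by simp
  ultimately show ?thesis using that by blast
qed

text \<open>The monomials over one image are the colourings of one replication, so the ideal generated by the
  quadratic binomials contains the difference of any two of them.\<close>

theorem quadratic_if_kempe_equivalent:
  fixes G :: "'a graph"
  assumes G: "simple_graph G"
    and kempe: "\<And>(H :: nat graph) \<pi> k c d. \<lbrakk>is_replication H G \<pi>; proper_colouring H k c;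
       proper_colouring H k d\<rbrakk> \<Longrightarrow> (kempe_step H k)\<^sup>*\<^sup>* c d"
  shows "quadratic_stable_set_ring (K :: 'k::field itself) G"
proof -
  interpret R: ring "poly_ring (stable_sets G) :: ('a set, 'k) mpoly ring" by (rule ring_poly_ring)
  interpret I: ideal "stable_set_ideal K G" "poly_ring (stable_sets G)" by (rule ideal_stable_set_ideal)
  define B where "B = quadratic_binomials (stable_sets G) \<inter> stable_set_ideal K G"
  define J where "J = Idl\<^bsub>poly_ring (stable_sets G)\<^esub> B"
  have Bc: "B \<subseteq> carrier (poly_ring (stable_sets G))" using I.Icarr by (auto simp: B_def)
  have J: "ideal J (poly_ring (stable_sets G))" unfolding J_def by (rule R.genideal_ideal[OF Bc])
  have BJ: "B \<subseteq> J" unfolding J_def by (rule R.genideal_self[OF Bc])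
  interpret J: ideal J "poly_ring (stable_sets G)" by (rule J)
  have quadratic: "Poly_Mapping.single (Poly_Mapping.single S 1 + Poly_Mapping.single S' 1) 1
          - Poly_Mapping.single (Poly_Mapping.single T 1 + Poly_Mapping.single T' 1) 1 \<in> J"
    if S: "{S, S', T, T'} \<subseteq> stable_sets G" "set_exponent S + set_exponent S' = set_exponent T + set_exponent T'"
    for S S' T T'
  proof -
    let ?a = "Poly_Mapping.single S 1 + Poly_Mapping.single S' (1::nat)"
    let ?b = "Poly_Mapping.single T 1 + Poly_Mapping.single T' (1::nat)"
    have keys: "Poly_Mapping.keys ?a \<subseteq> stable_sets G" "Poly_Mapping.keys ?b \<subseteq> stable_sets G"
      using S(1) Poly_Mapping.keys_add[of "Poly_Mapping.single S (1::nat)" "Poly_Mapping.single S' 1"]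
        Poly_Mapping.keys_add[of "Poly_Mapping.single T (1::nat)" "Poly_Mapping.single T' 1"] by auto
    have deg: "monom_degree (Poly_Mapping.single X 1 + Poly_Mapping.single Y 1) = 2" for X Y :: "'a set"
      by (simp add: monom_degree_add)
    show ?thesis
    proof (cases "?a = ?b")
      case True
      then show ?thesis
        using additive_subgroup.zero_closed[OF J.is_additive_subgroup] by (simp add: poly_ring_def)
    next
      case False
      have "Poly_Mapping.single ?a 1 - Poly_Mapping.single ?b (1::'k) \<in> quadratic_binomials (stable_sets G)"
        unfolding quadratic_binomials_def using False keys deg by blast
      moreover have "Poly_Mapping.single ?a 1 - Poly_Mapping.single ?b (1::'k) \<in> stable_set_ideal K G"
        using binomial_mem_stable_set_ideal_iff[OF False, of K G] keys S(2) by (simp add: image_exponent_add)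
      ultimately show ?thesis using BJ by (auto simp: B_def)
    qed
  qed
  have "stable_set_ideal K G \<subseteq> J"
  proof (rule stable_set_ideal_subset[OF J])
    fix u w assume uw: "Poly_Mapping.keys u \<subseteq> stable_sets G" "Poly_Mapping.keys w \<subseteq> stable_sets G"
      "image_exponent u = image_exponent w"
    obtain H :: "nat graph" and \<pi> k c d where H: "is_replication H G \<pi>"
      "proper_colouring H k c" "proper_colouring H k d"
      and M: "colouring_monomial k (verts H) \<pi> c = u" "colouring_monomial k (verts H) \<pi> d = w"
      by (rule monomials_as_colourings[OF G uw])
    show "Poly_Mapping.single u 1 - Poly_Mapping.single w 1 \<in> J"
      using kempe_equivalent_binomial[OF G H(1) J quadratic kempe[OF H]] unfolding M .
  qed
  moreover have "J \<subseteq> stable_set_ideal K G"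
    unfolding J_def by (rule R.genideal_minimal[OF ideal_stable_set_ideal]) (simp add: B_def)
  ultimately show ?thesis
    unfolding quadratic_stable_set_ring_def J_def by (intro exI[of _ B]) (auto simp: B_def)
qed

section \<open>Induced subgraphs without true twins\<close>

text \<open>The three excluded kinds of graphs are preserved by renaming vertices injectively; this renaming
  carries an induced subgraph of a replication to one of \<open>G\<close>.\<close>

definition map_graph :: "('a \<Rightarrow> 'b) \<Rightarrow> 'a graph \<Rightarrow> 'b graph" where
  "map_graph f G = \<lparr>verts = f ` verts G, edges = (`) f ` edges G\<rparr>"

text \<open>True twins are adjacent vertices with the same other neighbours, as are two copies of one vertex
  in a replication.\<close>

definition true_twin_free :: "'a graph \<Rightarrow> bool" where
  "true_twin_free F \<longleftrightarrow> (\<forall>a \<in> verts F. \<forall>b \<in> verts F. a \<noteq> b \<and> adj F a b \<longrightarrow>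
     (\<exists>w \<in> verts F - {a, b}. adj F a w \<noteq> adj F b w))"

lemma adj_induced: "adj (induced G W) u v \<longleftrightarrow> adj G u v \<and> u \<in> W \<and> v \<in> W"
  by (simp add: adj_def induced_def)

lemma verts_induced [simp]: "verts (induced G W) = W"
  by (simp add: induced_def)

lemma simple_graph_induced: "simple_graph G \<Longrightarrow> W \<subseteq> verts G \<Longrightarrow> simple_graph (induced G W)"
  by (auto simp: simple_graph_def induced_def intro: finite_subset)

text \<open>Two elements of \<open>U\<close> over the same vertex would be true twins.\<close>

lemma twin_free_replication:
  assumes G: "simple_graph G" and H: "is_replication H G \<pi>" and U: "U \<subseteq> verts H"
    and twin: "true_twin_free (induced H U)"
  shows "inj_on \<pi> U" "induced G (\<pi> ` U) = map_graph \<pi> (induced H U)"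
proof -
  have adjH: "adj H u v \<longleftrightarrow> u \<noteq> v \<and> (\<pi> u = \<pi> v \<or> adj G (\<pi> u) (\<pi> v))" if "u \<in> U" "v \<in> U" for u v
    using H U that unfolding is_replication_def by blast
  show inj: "inj_on \<pi> U"
  proof (intro inj_onI, rule ccontr)
    fix a b assume ab: "a \<in> U" "b \<in> U" "\<pi> a = \<pi> b" "a \<noteq> b"
    then have "adj H a b" using adjH by blast
    then obtain w where "w \<in> U - {a, b}" "adj H a w \<noteq> adj H b w"
      using twin ab unfolding true_twin_free_def by (auto simp: adj_induced)
    then show False using adjH[of a w] adjH[of b w] ab by auto
  qed
  have simpleH: "simple_graph H" using H by (simp add: is_replication_def)
  have "{e \<in> edges G. e \<subseteq> \<pi> ` U} = (`) \<pi> ` {e \<in> edges H. e \<subseteq> U}"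
  proof (intro Set.set_eqI iffI)
    fix e assume "e \<in> {e \<in> edges G. e \<subseteq> \<pi> ` U}"
    then have e: "e \<in> edges G" "e \<subseteq> \<pi> ` U" by auto
    obtain x y where xy: "e = {x, y}" "adj G x y" "x \<noteq> y" using edge_cases[OF G e(1)] by metis
    then obtain a b where ab: "a \<in> U" "b \<in> U" "x = \<pi> a" "y = \<pi> b" using e(2) by auto
    then have "{a, b} \<in> edges H" using adjH[of a b] xy by (auto simp: adj_def)
    then show "e \<in> (`) \<pi> ` {e \<in> edges H. e \<subseteq> U}" using ab xy by (intro image_eqI[of _ _ "{a, b}"]) auto
  next
    fix e assume "e \<in> (`) \<pi> ` {e \<in> edges H. e \<subseteq> U}"
    then obtain e' where e': "e = \<pi> ` e'" "e' \<in> edges H" "e' \<subseteq> U" by auto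
    obtain a b where ab: "e' = {a, b}" "adj H a b" using edge_cases[OF simpleH e'(2)] by metis
    then have "adj G (\<pi> a) (\<pi> b)" using adjH[of a b] e'(3) inj by (auto simp: inj_on_def)
    then show "e \<in> {e \<in> edges G. e \<subseteq> \<pi> ` U}" using ab e' by (auto simp: adj_def)
  qed
  then show "induced G (\<pi> ` U) = map_graph \<pi> (induced H U)"
    by (simp add: map_graph_def induced_def)
qed

lemma contains_induced_replication:
  assumes G: "simple_graph G" and H: "is_replication H G \<pi>"
    and twin: "\<And>F :: 'b graph. simple_graph F \<Longrightarrow> P F \<Longrightarrow> true_twin_free F"
    and iso: "\<And>(F :: 'b graph) (f :: 'b \<Rightarrow> 'a). simple_graph F \<Longrightarrow> P F \<Longrightarrow> inj_on f (verts F) \<Longrightarrow> Q (map_graph f F)"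
    and "contains_induced P H"
  shows "contains_induced Q G"
proof -
  obtain U where U: "U \<subseteq> verts H" "P (induced H U)"
    using assms(5) unfolding contains_induced_def by blast
  have F: "simple_graph (induced H U)"
    using simple_graph_induced U(1) H by (auto simp: is_replication_def)
  note t = twin_free_replication[OF G H U(1) twin[OF F U(2)]]
  have "Q (induced G (\<pi> ` U))" unfolding t(2) by (rule iso[OF F U(2)]) (simp add: t(1))
  moreover have "\<pi> ` U \<subseteq> verts G" using U(1) H by (auto simp: is_replication_def)
  ultimately show ?thesis unfolding contains_induced_def by blast
qed

section \<open>Cycles and antiholes\<close>

lemma path_edges_image: "path_edges p = (\<lambda>i. {p ! i, p ! Suc i}) ` {i. Suc i < length p}"
  by (auto simp: path_edges_def)

lemma path_edges_map: "path_edges (map f p) = (`) f ` path_edges p"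
  unfolding path_edges_image image_image by (rule image_cong) auto

lemma is_cycle_map_graph:
  assumes "is_cycle n F" "inj_on f (verts F)"
  shows "is_cycle n (map_graph f F)"
proof -
  from assms(1) obtain p where p: "3 \<le> n" "length p = n" "distinct p" "verts F = set p"
    "edges F = insert {last p, hd p} (path_edges p)" unfolding is_cycle_def by blast
  then have "p \<noteq> []" by auto
  then show ?thesis unfolding is_cycle_def
    using p assms(2) by (intro conjI exI[of _ "map f p"])
      (simp_all add: map_graph_def distinct_map path_edges_map last_map hd_map)
qed

lemma complement_map_graph:
  assumes "simple_graph F" "inj_on f (verts F)"
  shows "complement (map_graph f F) = map_graph f (complement F)"
proof -
  have E: "\<And>e. e \<in> edges F \<Longrightarrow> e \<subseteq> verts F" using assms(1) by (auto simp: simple_graph_def)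
  have "f ` e \<in> (`) f ` edges F \<longleftrightarrow> e \<in> edges F" if "e \<subseteq> verts F" for e
  proof
    assume "f ` e \<in> (`) f ` edges F"
    then obtain e' where "e' \<in> edges F" "f ` e = f ` e'" by blast
    then show "e \<in> edges F" using inj_on_image_eq_iff[OF assms(2) that E] by blast
  qed blast
  note edge = this
  have card: "card (f ` e) = card e" if "e \<subseteq> verts F" for e
    using that assms(2) by (meson card_image inj_on_subset)
  have "{e. e \<subseteq> f ` verts F \<and> card e = 2 \<and> e \<notin> (`) f ` edges F} =
      (`) f ` {e. e \<subseteq> verts F \<and> card e = 2 \<and> e \<notin> edges F}"
  proof (intro Set.set_eqI iffI)
    fix e assume e: "e \<in> {e. e \<subseteq> f ` verts F \<and> card e = 2 \<and> e \<notin> (`) f ` edges F}"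
    then obtain e' where e': "e' \<subseteq> verts F" "e = f ` e'" by (auto simp: subset_image_iff)
    then show "e \<in> (`) f ` {e. e \<subseteq> verts F \<and> card e = 2 \<and> e \<notin> edges F}"
      using e edge[OF e'(1)] card[OF e'(1)] by auto
  next
    fix e assume "e \<in> (`) f ` {e. e \<subseteq> verts F \<and> card e = 2 \<and> e \<notin> edges F}"
    then obtain e' where e': "e' \<subseteq> verts F" "card e' = 2" "e' \<notin> edges F" "e = f ` e'" by auto
    then show "e \<in> {e. e \<subseteq> f ` verts F \<and> card e = 2 \<and> e \<notin> (`) f ` edges F}"
      using edge[OF e'(1)] card[OF e'(1)] by auto
  qed
  then show ?thesis unfolding complement_def map_graph_def by simp
qed

lemma mod_Suc_cases: "a < n \<Longrightarrow> Suc a mod n = (if a = n - 1 then 0 else Suc a)" for n :: nat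
  by (cases "Suc a = n") auto

lemma cycle_adj:
  assumes n: "3 \<le> n" "length p = n" "distinct p"
    and E: "edges F = insert {last p, hd p} (path_edges p)" and ij: "i < n" "j < n"
  shows "adj F (p ! i) (p ! j) \<longleftrightarrow> j = Suc i mod n \<or> i = Suc j mod n"
proof -
  have ne: "p \<noteq> []" using n by auto
  have eq: "p ! a = p ! b \<longleftrightarrow> a = b" if "a < n" "b < n" for a b
    using that n by (simp add: nth_eq_iff_index_eq)
  have path: "{p ! i, p ! j} \<in> path_edges p \<longleftrightarrow> j = Suc i \<or> i = Suc j"
  proof
    assume "{p ! i, p ! j} \<in> path_edges p"
    then obtain a where a: "Suc a < n" "{p ! i, p ! j} = {p ! a, p ! Suc a}"
      using n by (auto simp: path_edges_def)
    then show "j = Suc i \<or> i = Suc j"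
      using eq[of i a] eq[of i "Suc a"] eq[of j a] eq[of j "Suc a"] ij by (auto simp: doubleton_eq_iff)
  next
    assume "j = Suc i \<or> i = Suc j"
    then show "{p ! i, p ! j} \<in> path_edges p"
      using ij n by (auto simp: path_edges_def insert_commute)
  qed
  have ends: "{p ! i, p ! j} = {last p, hd p} \<longleftrightarrow> (i = n - 1 \<and> j = 0) \<or> (i = 0 \<and> j = n - 1)"
    using eq[of i "n - 1"] eq[of i 0] eq[of j "n - 1"] eq[of j 0] ij ne n
    by (auto simp: doubleton_eq_iff last_conv_nth hd_conv_nth)
  show ?thesis
    unfolding adj_def E insert_iff path ends mod_Suc_cases[OF ij(1)] mod_Suc_cases[OF ij(2)] using n ij by auto
qed

lemma cycle_vertices:
  assumes "is_cycle n F"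
  obtains f where "3 \<le> n" "bij_betw f {..<n} (verts F)"
    "\<And>i j. i < n \<Longrightarrow> j < n \<Longrightarrow> adj F (f i) (f j) \<longleftrightarrow> j = Suc i mod n \<or> i = Suc j mod n"
proof -
  from assms obtain p where p: "3 \<le> n" "length p = n" "distinct p" "verts F = set p"
    "edges F = insert {last p, hd p} (path_edges p)" unfolding is_cycle_def by blast
  show ?thesis
  proof (rule that[OF p(1)])
    show "bij_betw ((!) p) {..<n} (verts F)" using p bij_betw_nth by blast
  qed (rule cycle_adj[OF p(1,2,3,5)])
qed

text \<open>Two consecutive vertices are told apart by the vertex that follows them.\<close>

lemma cycle_true_twin_free:
  assumes "is_cycle n F" "4 \<le> n"
  shows "true_twin_free F"
proof -
  obtain f where f: "bij_betw f {..<n} (verts F)"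
    and adj: "\<And>i j. i < n \<Longrightarrow> j < n \<Longrightarrow> adj F (f i) (f j) \<longleftrightarrow> j = Suc i mod n \<or> i = Suc j mod n"
    using cycle_vertices[OF assms(1)] by metis
  have eq: "f i = f j \<longleftrightarrow> i = j" if "i < n" "j < n" for i j
    using f that by (auto simp: bij_betw_def inj_on_def)
  have twin: "\<exists>w \<in> verts F - {f i, f j}. adj F (f i) w \<noteq> adj F (f j) w" if ij: "i < n" "j = Suc i mod n" for i j
  proof (rule bexI[of _ "f (Suc j mod n)"])
    have j: "j < n" "Suc j mod n < n" using ij assms(2) by auto
    show "f (Suc j mod n) \<in> verts F - {f i, f j}"
      using f j ij eq assms(2) mod_Suc_cases[of i n] mod_Suc_cases[of j n]
      by (auto simp: bij_betw_def split: if_splits)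
    define s where "s = Suc j mod n"
    have s: "s < n" "s = (if j = n - 1 then 0 else Suc j)" "j = (if i = n - 1 then 0 else Suc i)"
      "Suc s mod n = (if s = n - 1 then 0 else Suc s)"
      using j ij mod_Suc_cases s_def by auto
    have "s \<noteq> j" "i \<noteq> Suc s mod n" unfolding s(4) using s(1-3) ij(1) assms(2) by presburger+
    then have "\<not> adj F (f i) (f s)" using adj[OF ij(1) s(1)] ij(2) by simp
    moreover have "adj F (f j) (f s)" using adj[OF j(1) s(1)] s_def by simp
    ultimately show "adj F (f i) (f (Suc j mod n)) \<noteq> adj F (f j) (f (Suc j mod n))"
      by (simp add: s_def)
  qed
  show ?thesis
    unfolding true_twin_free_def
  proof (intro ballI impI)
    fix a b assume ab: "a \<in> verts F" "b \<in> verts F" "a \<noteq> b \<and> adj F a b"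
    then obtain i j where ij: "a = f i" "b = f j" "i < n" "j < n"
      using bij_betw_imp_surj_on[OF f] by blast
    then have "j = Suc i mod n \<or> i = Suc j mod n" using ab adj by blast
    then show "\<exists>w \<in> verts F - {a, b}. adj F a w \<noteq> adj F b w"
      using twin[of i j] twin[of j i] ij by (auto simp: insert_commute)
  qed
qed

lemma adj_complement:
  "adj (complement F) u v \<longleftrightarrow> u \<in> verts F \<and> v \<in> verts F \<and> u \<noteq> v \<and> \<not> adj F u v"
  by (auto simp: adj_def complement_def)

lemma antihole_vertices:
  assumes "is_antihole F"
  obtains n f where "5 \<le> n" "bij_betw f {..<n} (verts F)"
    "\<And>i j. i < n \<Longrightarrow> j < n \<Longrightarrow> i \<noteq> j \<Longrightarrow>
       adj F (f i) (f j) \<longleftrightarrow> \<not> (j = Suc i mod n \<or> i = Suc j mod n)"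
proof -
  obtain n where n: "5 \<le> n" "is_cycle n (complement F)"
    using assms by (auto simp: is_antihole_def is_hole_def)
  obtain f where f: "bij_betw f {..<n} (verts (complement F))"
    and adj: "\<And>i j. i < n \<Longrightarrow> j < n \<Longrightarrow> adj (complement F) (f i) (f j) \<longleftrightarrow> j = Suc i mod n \<or> i = Suc j mod n"
    using cycle_vertices[OF n(2)] by metis
  have f': "bij_betw f {..<n} (verts F)" using f by (simp add: complement_def)
  show ?thesis
  proof (rule that[OF n(1) f'])
    fix i j assume ij: "i < n" "j < n" "i \<noteq> j"
    then have "f i \<in> verts F" "f j \<in> verts F" "f i \<noteq> f j"
      using f' by (auto simp: bij_betw_def inj_on_def)
    then show "adj F (f i) (f j) \<longleftrightarrow> \<not> (j = Suc i mod n \<or> i = Suc j mod n)"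
      using adj[OF ij(1,2)] by (auto simp: adj_complement)
  qed
qed

text \<open>True twins of an antihole are false twins of the complementary cycle: two vertices with the same
  two neighbours, which exist only in a cycle of length four.\<close>

lemma antihole_true_twin_free:
  assumes "is_antihole F"
  shows "true_twin_free F"
proof -
  obtain n f where n: "5 \<le> n" and f: "bij_betw f {..<n} (verts F)"
    and adj: "\<And>i j. i < n \<Longrightarrow> j < n \<Longrightarrow> i \<noteq> j \<Longrightarrow>
       adj F (f i) (f j) \<longleftrightarrow> \<not> (j = Suc i mod n \<or> i = Suc j mod n)"
    using antihole_vertices[OF assms] by metis
  have eq: "f i = f j \<longleftrightarrow> i = j" if "i < n" "j < n" for i j
    using f that by (auto simp: bij_betw_def inj_on_def)
  have twin: "\<exists>w \<in> verts F - {f i, f j}. adj F (f i) w \<noteq> adj F (f j) w"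
    if ij: "i < n" "j < n" "i \<noteq> j" "j \<noteq> Suc i mod n" "i \<noteq> Suc j mod n" "j \<noteq> Suc (Suc i mod n) mod n" for i j
  proof (rule bexI[of _ "f (Suc i mod n)"])
    have i: "Suc i mod n < n" using n by simp
    show "f (Suc i mod n) \<in> verts F - {f i, f j}"
      using f i ij eq n mod_Suc_cases[of i n]
      by (auto simp: bij_betw_def split: if_splits)
    have "i \<noteq> Suc i mod n" using ij n mod_Suc_cases[of i n] by (auto split: if_splits)
    moreover have "Suc i mod n \<noteq> Suc j mod n"
      using ij n mod_Suc_cases[of i n] mod_Suc_cases[of j n] by (auto split: if_splits)
    ultimately show "adj F (f i) (f (Suc i mod n)) \<noteq> adj F (f j) (f (Suc i mod n))"
      using i ij adj[of i "Suc i mod n"] adj[of j "Suc i mod n"] by auto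
  qed
  show ?thesis
    unfolding true_twin_free_def
  proof (intro ballI impI)
    fix a b assume ab: "a \<in> verts F" "b \<in> verts F" "a \<noteq> b \<and> adj F a b"
    then obtain i j where ij: "a = f i" "b = f j" "i < n" "j < n"
      using bij_betw_imp_surj_on[OF f] by blast
    then have "i \<noteq> j" using ab by auto
    then have c: "i \<noteq> j" "j \<noteq> Suc i mod n" "i \<noteq> Suc j mod n"
      using ab ij adj[of i j] by auto
    \<comment> \<open>The vertices \<open>i\<close> and \<open>j\<close> cannot be two steps apart in both directions.\<close>
    have "\<not> (j = Suc (Suc i mod n) mod n \<and> i = Suc (Suc j mod n) mod n)"
    proof -
      have "i \<noteq> (i + 4) mod n"
      proof
        assume "i = (i + 4) mod n"
        then have "(i + 4) mod n = i mod n" using ij(3) mod_less by metis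
        then have "n dvd 4" by (simp add: mod_eq_dvd_iff_nat)
        then show False using n by (auto dest: dvd_imp_le)
      qed
      moreover have "Suc (Suc (Suc (Suc i mod n) mod n) mod n) mod n = (i + 4) mod n"
        by (simp add: mod_simps eval_nat_numeral)
      ultimately show ?thesis by metis
    qed
    then show "\<exists>w \<in> verts F - {a, b}. adj F a w \<noteq> adj F b w"
      using twin[of i j] twin[of j i] ij c by (auto simp: insert_commute)
  qed
qed

section \<open>Odd prisms\<close>

lemma less_3_cases: "(s::nat) < 3 \<longleftrightarrow> s = 0 \<or> s = 1 \<or> s = 2"
  by auto

text \<open>Coordinates on a prism: \<open>x s i\<close> is the vertex number \<open>i\<close> on the path number \<open>s\<close>, which has \<open>len s\<close>
  vertices. They make the three paths interchangeable.\<close>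

definition prism_labelling :: "'a graph \<Rightarrow> (nat \<Rightarrow> nat) \<Rightarrow> (nat \<Rightarrow> nat \<Rightarrow> 'a) \<Rightarrow> bool" where
  "prism_labelling F len x \<longleftrightarrow>
     (\<forall>s<3. even (len s) \<and> 0 < len s) \<and>
     (\<forall>s<3. \<forall>t<3. \<forall>i<len s. \<forall>j<len t. x s i = x t j \<longleftrightarrow> s = t \<and> i = j) \<and>
     verts F = {x s i | s i. s < 3 \<and> i < len s} \<and>
     (\<forall>s<3. \<forall>t<3. \<forall>i<len s. \<forall>j<len t. adj F (x s i) (x t j) \<longleftrightarrow>
        (s = t \<and> (j = Suc i \<or> i = Suc j)) \<or>
        (s \<noteq> t \<and> (i = 0 \<and> j = 0 \<or> Suc i = len s \<and> Suc j = len t)))"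

lemma prism_labellingD:
  assumes "prism_labelling F len x"
  shows "s < 3 \<Longrightarrow> even (len s)" "s < 3 \<Longrightarrow> 0 < len s"
    "verts F = {x s i | s i. s < 3 \<and> i < len s}"
    "\<lbrakk>s < 3; t < 3; i < len s; j < len t\<rbrakk> \<Longrightarrow> x s i = x t j \<longleftrightarrow> s = t \<and> i = j"
    "\<lbrakk>s < 3; t < 3; i < len s; j < len t\<rbrakk> \<Longrightarrow> adj F (x s i) (x t j) \<longleftrightarrow>
        (s = t \<and> (j = Suc i \<or> i = Suc j)) \<or>
        (s \<noteq> t \<and> (i = 0 \<and> j = 0 \<or> Suc i = len s \<and> Suc j = len t))"
proof -
  note conj = assms[unfolded prism_labelling_def]
  show "s < 3 \<Longrightarrow> even (len s)" "s < 3 \<Longrightarrow> 0 < len s"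
    using conj[THEN conjunct1] by blast+
  show "verts F = {x s i | s i. s < 3 \<and> i < len s}"
    by (rule conj[THEN conjunct2, THEN conjunct2, THEN conjunct1])
  show "\<lbrakk>s < 3; t < 3; i < len s; j < len t\<rbrakk> \<Longrightarrow> x s i = x t j \<longleftrightarrow> s = t \<and> i = j"
    by (rule conj[THEN conjunct2, THEN conjunct1, rule_format])
  show "\<lbrakk>s < 3; t < 3; i < len s; j < len t\<rbrakk> \<Longrightarrow> adj F (x s i) (x t j) \<longleftrightarrow>
        (s = t \<and> (j = Suc i \<or> i = Suc j)) \<or>
        (s \<noteq> t \<and> (i = 0 \<and> j = 0 \<or> Suc i = len s \<and> Suc j = len t))"
    by (rule conj[THEN conjunct2, THEN conjunct2, THEN conjunct2, rule_format])
qed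

lemma triangle_edges_eq:
  "triangle_edges (v 0) (v 1) (v 2) = {{v s, v t} | s t. s < 3 \<and> t < 3 \<and> s \<noteq> (t::nat)}"
proof
  show "triangle_edges (v 0) (v 1) (v 2) \<subseteq> {{v s, v t} | s t. s < 3 \<and> t < 3 \<and> s \<noteq> t}"
    unfolding triangle_edges_def
    using less_3_cases[of 0] less_3_cases[of 1] less_3_cases[of 2]
    by (intro insert_subsetI empty_subsetI CollectI)
      (rule exI[of _ 0] exI[of _ 1], rule exI[of _ 1] exI[of _ 2], force)+
qed (auto simp: triangle_edges_def less_3_cases insert_commute)

lemma odd_prism_labelling:
  assumes "is_odd_prism F"
  obtains len x where "prism_labelling F len x"
proof -
  from assms obtain p q r where d: "distinct (p @ q @ r)"
    and odd: "\<forall>l \<in> {p, q, r}. l \<noteq> [] \<and> odd (length l - 1)"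
    and V: "verts F = set p \<union> set q \<union> set r"
    and E: "edges F = path_edges p \<union> path_edges q \<union> path_edges r
          \<union> triangle_edges (hd p) (hd q) (hd r) \<union> triangle_edges (last p) (last q) (last r)"
    unfolding is_odd_prism_def by blast
  define L where "L s = [p, q, r] ! s" for s
  define len where "len s = length (L s)" for s
  define x where "x s i = L s ! i" for s i
  have L: "L 0 = p" "L 1 = q" "L 2 = r" "L (Suc 0) = q" by (simp_all add: L_def)
  have len: "even (len s)" "0 < len s" if "s < 3" for s
  proof -
    have "L s \<in> {p, q, r}" using that L by (auto simp: less_3_cases)
    then have "L s \<noteq> []" "odd (length (L s) - 1)" using odd by blast+
    then show "even (len s)" "0 < len s" by (auto simp: len_def)
  qed
  have mem: "x s i \<in> set (L s)" if "i < len s" for s i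
    using that by (simp add: x_def len_def)
  have disj: "set (L s) \<inter> set (L t) = {}" if "s < 3" "t < 3" "s \<noteq> t" for s t
    using that d L unfolding less_3_cases by auto
  have dist: "distinct (L s)" if "s < 3" for s
    using that d L unfolding less_3_cases by auto
  have inj: "x s i = x t j \<longleftrightarrow> s = t \<and> i = j" if "s < 3" "t < 3" "i < len s" "j < len t" for s t i j
  proof (cases "s = t")
    case True
    then show ?thesis using that dist[of s] by (auto simp: x_def len_def nth_eq_iff_index_eq)
  next
    case False
    then show ?thesis using disj[of s t] mem[of i s] mem[of j t] that by auto
  qed
  have hd: "hd (L s) = x s 0" "last (L s) = x s (len s - 1)" if "s < 3" for s
    using len(2)[OF that] by (auto simp: x_def len_def hd_conv_nth last_conv_nth)
  have path: "path_edges p \<union> path_edges q \<union> path_edges r =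
      {{x s i, x s (Suc i)} | s i. s < 3 \<and> Suc i < len s}"
  proof -
    have "{{x s i, x s (Suc i)} | s i. s < 3 \<and> Suc i < len s} = (\<Union>s \<in> {0, 1, 2}. path_edges (L s))"
      unfolding path_edges_def x_def len_def by (auto simp: less_3_cases; blast)
    then show ?thesis by (simp add: L Un_assoc)
  qed
  have tri: "triangle_edges (hd p) (hd q) (hd r) = {{x s 0, x t 0} | s t. s < 3 \<and> t < 3 \<and> s \<noteq> t}"
    using triangle_edges_eq[of "\<lambda>s. x s 0"] hd(1)[of 0] hd(1)[of 1] hd(1)[of 2] by (simp add: L)
  have tri': "triangle_edges (last p) (last q) (last r) =
      {{x s (len s - 1), x t (len t - 1)} | s t. s < 3 \<and> t < 3 \<and> s \<noteq> t}"
    using triangle_edges_eq[of "\<lambda>s. x s (len s - 1)"] hd(2)[of 0] hd(2)[of 1] hd(2)[of 2] by (simp add: L)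
  have A: "adj F (x s i) (x t j) \<longleftrightarrow>
        (s = t \<and> (j = Suc i \<or> i = Suc j)) \<or>
        (s \<noteq> t \<and> (i = 0 \<and> j = 0 \<or> Suc i = len s \<and> Suc j = len t))"
    if st: "s < 3" "t < 3" "i < len s" "j < len t" for s t i j
  proof -
    have "{x s i, x t j} \<in> {{x s i, x s (Suc i)} | s i. s < 3 \<and> Suc i < len s} \<longleftrightarrow>
        s = t \<and> (j = Suc i \<or> i = Suc j)"
    proof
      assume "{x s i, x t j} \<in> {{x s i, x s (Suc i)} | s i. s < 3 \<and> Suc i < len s}"
      then obtain s' i' where s': "s' < 3" "Suc i' < len s'" "{x s i, x t j} = {x s' i', x s' (Suc i')}"
        by blast
      then show "s = t \<and> (j = Suc i \<or> i = Suc j)"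
        using st inj[of s s' i i'] inj[of s s' i "Suc i'"] inj[of t s' j i'] inj[of t s' j "Suc i'"]
        by (auto simp: doubleton_eq_iff)
    qed (use st in \<open>auto simp: insert_commute\<close>)
    moreover have "{x s i, x t j} \<in> {{x s 0, x t 0} | s t. s < 3 \<and> t < 3 \<and> s \<noteq> t} \<longleftrightarrow>
        s \<noteq> t \<and> i = 0 \<and> j = 0"
    proof
      assume "{x s i, x t j} \<in> {{x s 0, x t 0} | s t. s < 3 \<and> t < 3 \<and> s \<noteq> t}"
      then obtain s' t' where s': "s' < 3" "t' < 3" "s' \<noteq> t'" "{x s i, x t j} = {x s' 0, x t' 0}"
        by blast
      then show "s \<noteq> t \<and> i = 0 \<and> j = 0"
        using st inj[of s s' i 0] inj[of s t' i 0] inj[of t s' j 0] inj[of t t' j 0] len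
        by (auto simp: doubleton_eq_iff)
    qed (use st in blast)
    moreover have "{x s i, x t j} \<in> {{x s (len s - 1), x t (len t - 1)} | s t. s < 3 \<and> t < 3 \<and> s \<noteq> t} \<longleftrightarrow>
        s \<noteq> t \<and> Suc i = len s \<and> Suc j = len t"
    proof
      assume "{x s i, x t j} \<in> {{x s (len s - 1), x t (len t - 1)} | s t. s < 3 \<and> t < 3 \<and> s \<noteq> t}"
      then obtain s' t' where s': "s' < 3" "t' < 3" "s' \<noteq> t'"
        "{x s i, x t j} = {x s' (len s' - 1), x t' (len t' - 1)}"
        by blast
      have "len s' - 1 < len s'" "len t' - 1 < len t'" using len s' by auto
      then show "s \<noteq> t \<and> Suc i = len s \<and> Suc j = len t"
        using s' st inj[of s s' i "len s' - 1"] inj[of s t' i "len t' - 1"]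
          inj[of t s' j "len s' - 1"] inj[of t t' j "len t' - 1"]
        by (auto simp: doubleton_eq_iff)
    next
      assume a: "s \<noteq> t \<and> Suc i = len s \<and> Suc j = len t"
      then have "i = len s - 1" "j = len t - 1" by auto
      then show "{x s i, x t j} \<in> {{x s (len s - 1), x t (len t - 1)} | s t. s < 3 \<and> t < 3 \<and> s \<noteq> t}"
        using st a by blast
    qed
    ultimately show ?thesis
      unfolding adj_def E path tri tri' Un_iff by blast
  qed
  have "verts F = {x s i | s i. s < 3 \<and> i < len s}"
  proof -
    have "{x s i | s i. s < 3 \<and> i < len s} = (\<Union>s \<in> {0, 1, 2}. set (L s))"
      unfolding x_def len_def set_conv_nth by (auto simp: less_3_cases; blast)
    then show ?thesis by (simp add: V L Un_assoc)
  qed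
  then have "prism_labelling F len x"
    unfolding prism_labelling_def using len inj A by simp
  then show ?thesis using that by blast
qed

text \<open>An edge of a path is told apart by the next vertex of the path in one of the two directions or, if
  the path is a single edge, by a further vertex of a triangle; an edge of a triangle by the
  path that leaves one of its ends.\<close>

lemma prism_true_twin_free:
  assumes "is_odd_prism F"
  shows "true_twin_free F"
proof -
  obtain len x where lab: "prism_labelling F len x" using odd_prism_labelling[OF assms] by blast
  note V = prism_labellingD(3)[OF lab] and inj = prism_labellingD(4)[OF lab]
    and A = prism_labellingD(5)[OF lab]
  have len: "2 \<le> len s" if "s < 3" for s
    using prism_labellingD(1,2)[OF lab that] by (cases "len s = 1") auto
  have sep: "\<exists>w \<in> verts F - {x s i, x t j}. adj F (x s i) w \<noteq> adj F (x t j) w"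
    if w: "u < 3" "l < len u" "(u, l) \<noteq> (s, i)" "(u, l) \<noteq> (t, j)"
      "adj F (x s i) (x u l) \<noteq> adj F (x t j) (x u l)"
      and st: "s < 3" "t < 3" "i < len s" "j < len t" for s t i j u l
    using w st V inj[OF w(1) st(1) w(2) st(3)] inj[OF w(1) st(2) w(2) st(4)]
    by (intro bexI[of _ "x u l"]) auto
  have step: "\<exists>w \<in> verts F - {x s i, x s (Suc i)}. adj F (x s i) w \<noteq> adj F (x s (Suc i)) w"
    if s: "s < 3" "Suc i < len s" for s i
  proof -
    have si: "i < len s" using s by simp
    consider l where "i = Suc l" | "Suc (Suc i) < len s" | "i = 0" "len s = 2"
    proof -
      have "i = 0 \<longrightarrow> Suc (Suc i) < len s \<or> len s = 2" using s by linarith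
      then show ?thesis using that by (cases i) blast+
    qed
    then show ?thesis
    proof cases
      case 1
      then show ?thesis using s A[of s s i l] A[of s s "Suc i" l]
        by (intro sep[of s l s i s "Suc i"]) auto
    next
      case 2
      then show ?thesis using s A[of s s i "Suc (Suc i)"] A[of s s "Suc i" "Suc (Suc i)"]
        by (intro sep[of s "Suc (Suc i)" s i s "Suc i"]) auto
    next
      case 3
      obtain t where t: "t < 3" "t \<noteq> s" by (metis less_3_cases zero_neq_one)
      then show ?thesis using 3 s len[of t] A[of s t i 0] A[of s t "Suc i" 0]
        by (intro sep[of t 0 s i s "Suc i"]) auto
    qed
  qed
  show ?thesis
    unfolding true_twin_free_def
  proof (intro ballI impI)
    fix a b assume ab: "a \<in> verts F" "b \<in> verts F" "a \<noteq> b \<and> adj F a b"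
    then obtain s i t j where st: "a = x s i" "b = x t j" "s < 3" "t < 3" "i < len s" "j < len t"
      unfolding V by blast
    consider "s = t" "j = Suc i" | "s = t" "i = Suc j" | "s \<noteq> t" "i = 0" "j = 0"
      | "s \<noteq> t" "Suc i = len s" "Suc j = len t"
      using A[OF st(3-6)] ab st by blast
    then show "\<exists>w \<in> verts F - {a, b}. adj F a w \<noteq> adj F b w"
    proof cases
      case 1
      then show ?thesis using step[of s i] st by simp
    next
      case 2
      then show ?thesis using step[of s j] st by (auto simp: insert_commute)
    next
      case 3
      then show ?thesis unfolding st(1,2)
        using st len[of s] len[of t] A[of s s i 1] A[of t s j 1]
        by (intro sep[of s 1 s i t j]) auto
    next
      case 4
      obtain l where l: "i = Suc l" using 4 len[OF st(3)] by (cases i) auto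
      then show ?thesis unfolding st(1,2)
        using 4 st len[of s] len[of t] A[of s s i l] A[of t s j l]
        by (intro sep[of s l s i t j]) auto
    qed
  qed
qed

lemma is_odd_prism_map_graph:
  assumes "is_odd_prism F" "inj_on f (verts F)"
  shows "is_odd_prism (map_graph f F)"
proof -
  from assms(1) obtain p q r where p: "distinct (p @ q @ r)"
    "\<forall>l \<in> {p, q, r}. l \<noteq> [] \<and> odd (length l - 1)"
    "verts F = set p \<union> set q \<union> set r"
    "edges F = path_edges p \<union> path_edges q \<union> path_edges r
          \<union> triangle_edges (hd p) (hd q) (hd r) \<union> triangle_edges (last p) (last q) (last r)"
    unfolding is_odd_prism_def by blast
  have "distinct (map f (p @ q @ r))"
    using p(1,3) assms(2) by (subst distinct_map) (simp add: Un_assoc)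
  moreover have "triangle_edges (f a) (f b) (f c) = (`) f ` triangle_edges a b c" for a b c
    by (simp add: triangle_edges_def)
  ultimately show ?thesis
    unfolding is_odd_prism_def
    using p by (intro exI[of _ "map f p"] exI[of _ "map f q"] exI[of _ "map f r"] conjI)
      (simp_all add: map_graph_def path_edges_map image_Un hd_map last_map)
qed

lemma forbidden_replication:
  assumes G: "simple_graph G" and H: "is_replication H G \<pi>"
  shows "contains_induced is_odd_hole H \<Longrightarrow> contains_induced is_odd_hole G"
    and "contains_induced is_antihole H \<Longrightarrow> contains_induced is_antihole G"
    and "contains_induced is_odd_prism H \<Longrightarrow> contains_induced is_odd_prism G"
proof -
  show "contains_induced is_odd_hole H \<Longrightarrow> contains_induced is_odd_hole G"
  proof (erule contains_induced_replication[OF G H, rotated 2])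
    fix F :: "'b graph" assume F: "is_odd_hole F"
    then obtain n where n: "5 \<le> n" "odd n" "is_cycle n F" by (auto simp: is_odd_hole_def)
    then show "true_twin_free F" by (intro cycle_true_twin_free[of n]) auto
    fix f :: "'b \<Rightarrow> 'a" assume "inj_on f (verts F)"
    then show "is_odd_hole (map_graph f F)"
      using n is_cycle_map_graph unfolding is_odd_hole_def by blast
  qed
  show "contains_induced is_antihole H \<Longrightarrow> contains_induced is_antihole G"
  proof (erule contains_induced_replication[OF G H, rotated 2])
    fix F :: "'b graph" assume F: "simple_graph F" "is_antihole F"
    show "true_twin_free F" by (rule antihole_true_twin_free[OF F(2)])
    fix f :: "'b \<Rightarrow> 'a" assume f: "inj_on f (verts F)"
    then have "inj_on f (verts (complement F))" by (simp add: complement_def)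
    then show "is_antihole (map_graph f F)"
      using F is_cycle_map_graph unfolding is_antihole_def is_hole_def complement_map_graph[OF F(1) f]
      by blast
  qed
  show "contains_induced is_odd_prism H \<Longrightarrow> contains_induced is_odd_prism G"
    by (erule contains_induced_replication[OF G H, rotated 2])
      (simp_all add: prism_true_twin_free is_odd_prism_map_graph)
qed

section \<open>Rigid covers by stable sets\<close>

lemma monom_degree_2:
  assumes "monom_degree u = 2"
  obtains S T where "u = Poly_Mapping.single S 1 + Poly_Mapping.single T 1"
    "S \<in> Poly_Mapping.keys u" "T \<in> Poly_Mapping.keys u"
proof -
  obtain As where As: "set As \<subseteq> Poly_Mapping.keys u" "u = (\<Sum>i<length As. Poly_Mapping.single (As ! i) 1)"
    by (rule monomial_as_list)
  have "monom_degree u = length As"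
    by (subst As(2)) (simp add: monom_degree_sum)
  then have len: "length As = 2" using assms by simp
  then have "As ! 0 \<in> Poly_Mapping.keys u" "As ! 1 \<in> Poly_Mapping.keys u"
    using As(1) nth_mem[of 0 As] nth_mem[of 1 As] by auto
  moreover have "u = Poly_Mapping.single (As ! 0) 1 + Poly_Mapping.single (As ! 1) 1"
    by (subst As(2)) (simp add: len numeral_2_eq_2)
  ultimately show ?thesis using that by blast
qed

text \<open>Connectedness of the subgraph induced on \<open>D\<close>, stated for truth-valued functions.\<close>

definition edge_connected_on :: "'a graph \<Rightarrow> 'a set \<Rightarrow> bool" where
  "edge_connected_on G D \<longleftrightarrow> (\<forall>P. (\<forall>a \<in> D. \<forall>b \<in> D. adj G a b \<longrightarrow> P a = P b) \<longrightarrow>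
     (\<forall>a \<in> D. \<forall>b \<in> D. P a = (P b :: bool)))"

lemma edge_connected_onI:
  assumes "\<And>P. (\<And>a b. a \<in> D \<Longrightarrow> b \<in> D \<Longrightarrow> adj G a b \<Longrightarrow> P a = P b) \<Longrightarrow> \<forall>a \<in> D. P a = (P c :: bool)"
  shows "edge_connected_on G D"
  unfolding edge_connected_on_def
proof (intro allI impI ballI)
  fix P :: "'a \<Rightarrow> bool" and a b
  assume P: "\<forall>a \<in> D. \<forall>b \<in> D. adj G a b \<longrightarrow> P a = P b" and ab: "a \<in> D" "b \<in> D"
  have "\<forall>a \<in> D. P a = P c" by (rule assms) (use P in simp)
  then show "P a = P b" using ab by simp
qed

text \<open>Both pairs partition the symmetric difference of \<open>S\<close> and \<open>T\<close> into two stable sets, so every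
  edge there changes sides in both; being on the same side in both partitions is therefore constant
  on a connected symmetric difference.\<close>

lemma stable_pair_unique:
  assumes conn: "edge_connected_on G ((S - T) \<union> (T - S))"
    and st: "S \<in> stable_sets G" "T \<in> stable_sets G" "S' \<in> stable_sets G" "T' \<in> stable_sets G"
    and eq: "\<And>v. of_bool (v \<in> S) + of_bool (v \<in> T) = (of_bool (v \<in> S') + of_bool (v \<in> T') :: nat)"
  shows "S' = S \<and> T' = T \<or> S' = T \<and> T' = S"
proof -
  let ?D = "(S - T) \<union> (T - S)"
  have D: "v \<in> ?D \<longleftrightarrow> (v \<in> S') \<noteq> (v \<in> T')" "v \<in> S \<inter> T \<longleftrightarrow> v \<in> S' \<inter> T'" for v
    using eq[of v] by (auto simp: of_bool_def split: if_splits)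
  have edge: "\<not> (v \<in> X \<and> w \<in> X)" if "adj G v w" "X \<in> {S, T, S', T'}" for v w X
    using that st unfolding stable_sets_def by blast
  have "(a \<in> S \<longleftrightarrow> a \<in> S') = (b \<in> S \<longleftrightarrow> b \<in> S')" if "a \<in> ?D" "b \<in> ?D" "adj G a b" for a b
    using D(1)[of a] D(1)[of b] that edge[OF that(3), of S] edge[OF that(3), of T]
      edge[OF that(3), of S'] edge[OF that(3), of T'] by auto
  then have const: "(a \<in> S \<longleftrightarrow> a \<in> S') = (b \<in> S \<longleftrightarrow> b \<in> S')" if "a \<in> ?D" "b \<in> ?D" for a b
    using conn[unfolded edge_connected_on_def, rule_format, of "\<lambda>a. a \<in> S \<longleftrightarrow> a \<in> S'"] that by blast
  show ?thesis
  proof (cases "\<forall>a \<in> ?D. a \<in> S \<longleftrightarrow> a \<in> S'")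
    case True
    then have "v \<in> S' \<longleftrightarrow> v \<in> S" "v \<in> T' \<longleftrightarrow> v \<in> T" for v
      using D[of v] by blast+
    then show ?thesis by blast
  next
    case False
    then have "\<forall>a \<in> ?D. a \<in> S \<longleftrightarrow> a \<notin> S'" using const by blast
    then have "v \<in> S' \<longleftrightarrow> v \<in> T" "v \<in> T' \<longleftrightarrow> v \<in> S" for v
      using D[of v] by blast+
    then show ?thesis by blast
  qed
qed

text \<open>A pair of factors of the product of the variables in \<open>\<A>\<close> is determined by its vertex
  multiplicities, hence no quadratic binomial of the ideal applies to this product, although the
  product over \<open>\<B>\<close> has the same image.\<close>

lemma not_quadratic_if_rigid:
  assumes G: "simple_graph G"
    and A: "finite \<A>" "\<A> \<subseteq> stable_sets G" and B: "finite \<B>" "\<B> \<subseteq> stable_sets G"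
    and ne: "\<A> \<noteq> \<B>" and card: "card \<A> = card \<B>"
    and count: "\<And>v. card {S \<in> \<A>. v \<in> S} = card {S \<in> \<B>. v \<in> S}"
    and conn: "\<And>S T. S \<in> \<A> \<Longrightarrow> T \<in> \<A> \<Longrightarrow> S \<noteq> T \<Longrightarrow> edge_connected_on G ((S - T) \<union> (T - S))"
  shows "\<not> quadratic_stable_set_ring (K :: 'k::field itself) G"
proof -
  define mon where "mon \<S> = (\<Sum>S \<in> \<S>. Poly_Mapping.single S (1::nat))" for \<S> :: "'a set set"
  have lookup: "Poly_Mapping.lookup (mon \<S>) S = (if S \<in> \<S> then 1 else 0)" if "finite \<S>" for \<S> S
    using that by (simp add: mon_def lookup_sum lookup_single when_def)
  have keys: "Poly_Mapping.keys (mon \<S>) = \<S>" if "finite \<S>" for \<S>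
    using lookup[OF that] by (auto simp: in_keys_iff split: if_splits)
  have image: "image_exponent (mon \<S>) = (\<Sum>S \<in> \<S>. set_exponent S)" for \<S>
    by (simp add: mon_def image_exponent_sum)
  have fin: "finite S" if "S \<in> stable_sets G" for S by (rule finite_stable_set[OF G that])
  have pair: "Poly_Mapping.lookup (set_exponent S + set_exponent T) (Tvar v) = of_bool (v \<in> S) + of_bool (v \<in> T)"
    if "S \<in> stable_sets G" "T \<in> stable_sets G" for S T v
    using that fin by (simp add: lookup_add lookup_set_exponent)
  show ?thesis
  proof (rule isolated_monomial_not_quadratic)
    show "Poly_Mapping.keys (mon \<A>) \<subseteq> stable_sets G" "Poly_Mapping.keys (mon \<B>) \<subseteq> stable_sets G"
      using A B keys by simp_all
    show "mon \<A> \<noteq> mon \<B>" using keys A(1) B(1) ne by metis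
    have "(\<Sum>S \<in> \<A>. set_exponent S) = (\<Sum>S \<in> \<B>. set_exponent S) \<longleftrightarrow>
        card \<A> = card \<B> \<and> (\<forall>v. card {S \<in> \<A>. v \<in> S} = card {S \<in> \<B>. v \<in> S})"
      by (rule sum_set_exponent_eq_iff) (use A B fin in auto)
    then show "image_exponent (mon \<A>) = image_exponent (mon \<B>)"
      unfolding image using card count by blast
  next
    fix a b c
    assume a: "mon \<A> = a + c" "monom_degree a = 2" "Poly_Mapping.keys a \<subseteq> stable_sets G"
      and b: "monom_degree b = 2" "Poly_Mapping.keys b \<subseteq> stable_sets G"
      and ab: "image_exponent a = image_exponent b"
    obtain S T where S: "a = Poly_Mapping.single S 1 + Poly_Mapping.single T 1"
      "S \<in> Poly_Mapping.keys a" "T \<in> Poly_Mapping.keys a"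
      by (rule monom_degree_2[OF a(2)])
    obtain S' T' where S': "b = Poly_Mapping.single S' 1 + Poly_Mapping.single T' 1"
      "S' \<in> Poly_Mapping.keys b" "T' \<in> Poly_Mapping.keys b"
      by (rule monom_degree_2[OF b(1)])
    have st: "S \<in> stable_sets G" "T \<in> stable_sets G" "S' \<in> stable_sets G" "T' \<in> stable_sets G"
      using S S' a(3) b(2) by blast+
    have le: "Poly_Mapping.lookup a X \<le> (if X \<in> \<A> then 1 else 0)" for X
      using lookup[OF A(1), of X] a(1) by (simp add: lookup_add)
    have "S \<in> \<A>" "T \<in> \<A>" using le[of S] le[of T] S(2,3) by (auto simp: in_keys_iff split: if_splits)
    moreover have "S \<noteq> T"
      using le[of S] by (auto simp: S(1) lookup_add split: if_splits)
    ultimately have "edge_connected_on G ((S - T) \<union> (T - S))" by (rule conn)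
    moreover have sum: "set_exponent S + set_exponent T = set_exponent S' + set_exponent T'"
      using ab by (simp add: S(1) S'(1) image_exponent_add)
    have "of_bool (v \<in> S) + of_bool (v \<in> T) = (of_bool (v \<in> S') + of_bool (v \<in> T') :: nat)" for v
      using pair[OF st(1,2), of v] pair[OF st(3,4), of v] sum by simp
    ultimately have "S' = S \<and> T' = T \<or> S' = T \<and> T' = S"
      using stable_pair_unique[OF _ st] by blast
    then show "a = b" unfolding S(1) S'(1) by (auto simp: add.commute)
  qed
qed

lemma matching_cover:
  assumes "inj_on f {..<2 * m}"
  defines "\<M> \<equiv> (\<lambda>i. {f (2 * i), f (Suc (2 * i))}) ` {..<m}"
  shows "card \<M> = m" "card {S \<in> \<M>. v \<in> S} = (if v \<in> f ` {..<2 * m} then 1 else 0)"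
proof -
  have f: "f i = f j \<longleftrightarrow> i = j" if "i < 2 * m" "j < 2 * m" for i j
    using assms(1) that by (auto simp: inj_on_def)
  have mem: "f j \<in> {f (2 * i), f (Suc (2 * i))} \<longleftrightarrow> i = j div 2" if "i < m" "j < 2 * m" for i j
    using f[of j "2 * i"] f[of j "Suc (2 * i)"] that by auto
  have "inj_on (\<lambda>i. {f (2 * i), f (Suc (2 * i))}) {..<m}"
  proof (rule inj_onI)
    fix i j assume ij: "i \<in> {..<m}" "j \<in> {..<m}" "{f (2 * i), f (Suc (2 * i))} = {f (2 * j), f (Suc (2 * j))}"
    then have "f (2 * i) \<in> {f (2 * j), f (Suc (2 * j))}" by blast
    then show "i = j" using mem[of j "2 * i"] ij by simp
  qed
  then show "card \<M> = m" unfolding \<M>_def by (simp add: card_image)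
  show "card {S \<in> \<M>. v \<in> S} = (if v \<in> f ` {..<2 * m} then 1 else 0)"
  proof (cases "v \<in> f ` {..<2 * m}")
    case True
    then obtain j where j: "j < 2 * m" "v = f j" by auto
    have "{S \<in> \<M>. v \<in> S} = {{f (2 * (j div 2)), f (Suc (2 * (j div 2)))}}"
    proof (intro Set.set_eqI iffI)
      fix S assume "S \<in> {S \<in> \<M>. v \<in> S}"
      then obtain i where i: "i < m" "S = {f (2 * i), f (Suc (2 * i))}" "f j \<in> S"
        using j by (auto simp: \<M>_def)
      then have "i = j div 2" using mem[OF i(1) j(1)] by blast
      then show "S \<in> {{f (2 * (j div 2)), f (Suc (2 * (j div 2)))}}" using i by blast
    next
      fix S assume S: "S \<in> {{f (2 * (j div 2)), f (Suc (2 * (j div 2)))}}"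
      have "j div 2 < m" using j by auto
      then have "S \<in> \<M>" using S unfolding \<M>_def by blast
      moreover have "v \<in> S" using S mem[OF \<open>j div 2 < m\<close> j(1)] j(2) by blast
      ultimately show "S \<in> {S \<in> \<M>. v \<in> S}" by blast
    qed
    then show ?thesis using True by simp
  next
    case False
    have empty: "{S \<in> \<M>. v \<in> S} = {}"
    proof (rule ccontr)
      assume "\<not> ?thesis"
      then obtain i where "i < m" "v = f (2 * i) \<or> v = f (Suc (2 * i))"
        unfolding \<M>_def by blast
      then show False using False by (auto intro: imageI)
    qed
    show ?thesis unfolding empty using False by simp
  qed
qed

text \<open>The classes are the edges of one of the two perfect matchings of the complementary cycle. Two edges
  of a matching induce a four-cycle or a path on four vertices in the antihole, because the
  complementary cycle is longer than four.\<close>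

lemma even_antihole_not_quadratic:
  assumes G: "simple_graph G" and W: "W \<subseteq> verts G" and m: "3 \<le> m"
    and f: "bij_betw f {..<2 * m} W"
    and adj: "\<And>i j. i < 2 * m \<Longrightarrow> j < 2 * m \<Longrightarrow> i \<noteq> j \<Longrightarrow>
       adj G (f i) (f j) \<longleftrightarrow> \<not> (j = Suc i mod (2 * m) \<or> i = Suc j mod (2 * m))"
  shows "\<not> quadratic_stable_set_ring (K :: 'k::field itself) G"
proof -
  define n where "n = 2 * m"
  have n: "6 \<le> n" "even n" using m by (auto simp: n_def)
  define s where "s i = Suc i mod n" for i
  \<comment> \<open>Shifting the labels by one turns the first perfect matching into the second.\<close>
  define g where "g i = f (s i)" for i
  define M where "M h = (\<lambda>i. {h (2 * i), h (Suc (2 * i))}) ` {..<m}" for h :: "nat \<Rightarrow> 'a"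
  have s: "s i = (if i = n - 1 then 0 else Suc i)" "s i < n" if "i < n" for i
    unfolding s_def by (rule mod_Suc_cases[OF that]) (use n in simp)
  have even_step: "s (2 * i) = Suc (2 * i)" "2 * i < n" "Suc (2 * i) < n" if "i < m" for i
    using that n(2) s[of "2 * i"] unfolding n_def by auto
  have finj: "f i = f j \<longleftrightarrow> i = j" if "i < n" "j < n" for i j
    using f that by (auto simp: bij_betw_def n_def inj_on_def)
  have fimg: "f ` {..<n} = W" using f by (auto simp: bij_betw_def n_def)
  have sbij: "bij_betw s {..<n} {..<n}"
  proof -
    have "inj_on s {..<n}" using s by (auto simp: inj_on_def split: if_splits)
    moreover have "s ` {..<n} \<subseteq> {..<n}" using s by auto
    ultimately show ?thesis by (simp add: bij_betw_def endo_inj_surj)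
  qed
  have g: "bij_betw g {..<n} W"
    using bij_betw_trans[OF sbij, of f W] f by (simp add: n_def g_def[abs_def] comp_def)
  have adj: "adj G (f i) (f j) \<longleftrightarrow> \<not> (j = s i \<or> i = s j)" if "i < n" "j < n" "i \<noteq> j" for i j
    using adj that by (simp add: n_def s_def)
  have stable: "{f i, f (s i)} \<in> stable_sets G" if i: "i < n" for i
  proof -
    have "f i \<in> W" "f (s i) \<in> W" using fimg i s(2)[OF i] by auto
    moreover have "i \<noteq> s i" using s(1)[OF i] n i by (auto split: if_splits)
    then have "\<not> adj G (f i) (f (s i))" using adj[OF i s(2)[OF i]] by simp
    moreover have "\<not> adj G v v" for v using simple_graph_adjD[OF G] by blast
    ultimately show ?thesis using W adj_sym[of G "f i" "f (s i)"] by (auto simp: stable_sets_def)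
  qed
  have inj: "inj_on f {..<2 * m}" "inj_on g {..<2 * m}"
    using f g by (auto simp: bij_betw_def n_def)
  show ?thesis
  proof (rule not_quadratic_if_rigid[OF G, of "M f" "M g"])
    show "finite (M f)" "finite (M g)" by (simp_all add: M_def)
    show "M f \<subseteq> stable_sets G"
    proof
      fix S assume "S \<in> M f"
      then obtain i where i: "i < m" "S = {f (2 * i), f (Suc (2 * i))}" unfolding M_def by blast
      then show "S \<in> stable_sets G" using stable[of "2 * i"] even_step[OF i(1)] by simp
    qed
    show "M g \<subseteq> stable_sets G"
    proof
      fix S assume "S \<in> M g"
      then obtain i where i: "i < m" "S = {g (2 * i), g (Suc (2 * i))}" unfolding M_def by blast
      then show "S \<in> stable_sets G" using stable[of "Suc (2 * i)"] even_step[OF i(1)] by (simp add: g_def)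
    qed
    show "M f \<noteq> M g"
    proof
      assume eq: "M f = M g"
      have "{f 0, f 1} \<in> M f" unfolding M_def using m by (intro image_eqI[of _ _ 0]) auto
      then have "{f 0, f 1} \<in> M g" unfolding eq .
      then obtain i where i: "i < m" "{f 0, f 1} = {g (2 * i), g (Suc (2 * i))}"
        unfolding M_def by (elim imageE) (use that in simp)
      then have i: "i < m" "{f 0, f 1} = {f (Suc (2 * i)), f (s (Suc (2 * i)))}"
        using even_step(1)[of i] by (simp_all add: g_def)
      note lt = even_step(3)[OF i(1)]
      have "f 1 = f (Suc (2 * i))" "f 0 = f (s (Suc (2 * i)))"
        using i(2) finj[of 0 "Suc (2 * i)"] lt n by (auto simp: doubleton_eq_iff)
      then have "i = 0" "0 = s (Suc (2 * i))"
        using finj[of 1 "Suc (2 * i)"] finj[of 0 "s (Suc (2 * i))"] s(2)[OF lt] lt n by auto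
      moreover have "1 \<noteq> n - 1" "1 < n" using n by auto
      ultimately show False using s(1)[of 1] by simp
    qed
    show "card (M f) = card (M g)"
      unfolding M_def using matching_cover(1)[OF inj(1)] matching_cover(1)[OF inj(2)] by simp
    show "card {S \<in> M f. v \<in> S} = card {S \<in> M g. v \<in> S}" for v
      unfolding M_def matching_cover(2)[OF inj(1)] matching_cover(2)[OF inj(2)]
      using f g by (simp add: bij_betw_def n_def)
  next
    fix S T assume ST: "S \<in> M f" "T \<in> M f" "S \<noteq> T"
    then obtain i j where ij: "i < m" "S = {f (2 * i), f (Suc (2 * i))}"
       "j < m" "T = {f (2 * j), f (Suc (2 * j))}" unfolding M_def by blast
    have "i \<noteq> j" using ST ij by blast
    note i = even_step[OF ij(1)] and j = even_step[OF ij(3)]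
    have odd_step: "even (s (Suc (2 * l)))" if "l < m" for l
      using s(1)[OF even_step(3)[OF that]] by auto
    have D: "(S - T) \<union> (T - S) = {f (2 * i), f (Suc (2 * i)), f (2 * j), f (Suc (2 * j))}"
      using \<open>i \<noteq> j\<close> i j finj unfolding ij(2,4) by auto
    have ee: "adj G (f (2 * i)) (f (2 * j))"
      using adj[OF i(2) j(2)] \<open>i \<noteq> j\<close> i(1) j(1) by auto
    have oo: "adj G (f (Suc (2 * i))) (f (Suc (2 * j)))"
    proof -
      have "Suc (2 * j) \<noteq> s (Suc (2 * i))" "Suc (2 * i) \<noteq> s (Suc (2 * j))"
        using odd_step[OF ij(1)] odd_step[OF ij(3)] by (metis even_Suc dvd_triv_left)+
      then show ?thesis using adj[OF i(3) j(3)] \<open>i \<noteq> j\<close> by auto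
    qed
    \<comment> \<open>If both cross edges were missing, the cycle would close up after four steps.\<close>
    have "\<not> (2 * i = s (Suc (2 * j)) \<and> 2 * j = s (Suc (2 * i)))"
      using s(1)[OF i(3)] s(1)[OF j(3)] \<open>i \<noteq> j\<close> n by (auto split: if_splits)
    moreover have ne: "2 * i \<noteq> Suc (2 * j)" "2 * j \<noteq> Suc (2 * i)" by presburger+
    ultimately have eo: "adj G (f (2 * i)) (f (Suc (2 * j))) \<or> adj G (f (2 * j)) (f (Suc (2 * i)))"
      using adj[OF i(2) j(3) ne(1)] adj[OF j(2) i(3) ne(2)] i(1) j(1) \<open>i \<noteq> j\<close> by auto
    show "edge_connected_on G ((S - T) \<union> (T - S))"
      unfolding D
    proof (rule edge_connected_onI[of _ _ "f (2 * i)"])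
      fix P :: "'a \<Rightarrow> bool"
      assume P: "\<And>a b. \<lbrakk>a \<in> {f (2 * i), f (Suc (2 * i)), f (2 * j), f (Suc (2 * j))};
        b \<in> {f (2 * i), f (Suc (2 * i)), f (2 * j), f (Suc (2 * j))}; adj G a b\<rbrakk> \<Longrightarrow> P a = P b"
      have "P (f (2 * i)) = P (f (2 * j))" "P (f (Suc (2 * i))) = P (f (Suc (2 * j)))"
        using P ee oo by blast+
      moreover have "P (f (2 * i)) = P (f (Suc (2 * j))) \<or> P (f (2 * j)) = P (f (Suc (2 * i)))"
        using P eo by blast
      ultimately show "\<forall>a \<in> {f (2 * i), f (Suc (2 * i)), f (2 * j), f (Suc (2 * j))}. P a = P (f (2 * i))"
        by blast
    qed
  qed
qed

lemma card_filter_insert3: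
  assumes "distinct [A, B, C]"
  shows "card {S \<in> {A, B, C}. P S} = of_bool (P A) + of_bool (P B) + of_bool (P C)"
proof -
  have "card {S \<in> {A, B, C}. P S} = (\<Sum>S \<in> {A, B, C}. if P S then 1 else 0)"
    by (simp add: sum.If_cases Int_def)
  also have "\<dots> = of_bool (P A) + of_bool (P B) + of_bool (P C)"
    using assms by (simp add: of_bool_def)
  finally show ?thesis .
qed

text \<open>The stable set \<open>C s t u\<close> takes every other vertex of each path, starting at the first triangle on the
  path \<open>s\<close>, ending at the second triangle on the path \<open>t\<close> and avoiding both on the path \<open>u\<close>. The
  three cyclic rotations of \<open>(s, t, u)\<close> and the three rotations of the reversed order cover the prism
  with the same multiplicities. Two classes of one orientation differ along a single path: it runs
  back along \<open>s\<close> to the first triangle, passes to \<open>t\<close>, follows \<open>t\<close> to the second triangle and stops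
  at the end of \<open>u\<close>.\<close>

lemma odd_prism_not_quadratic:
  assumes G: "simple_graph G" and W: "W \<subseteq> verts G" and prism: "is_odd_prism (induced G W)"
  shows "\<not> quadratic_stable_set_ring (K :: 'k::field itself) G"
proof -
  obtain len x where lab: "prism_labelling (induced G W) len x"
    using odd_prism_labelling[OF prism] by blast
  have V: "W = {x s i | s i. s < 3 \<and> i < len s}" using prism_labellingD(3)[OF lab] by simp
  have xW: "x s i \<in> W" if "s < 3" "i < len s" for s i using that V by blast
  note inj = prism_labellingD(4)[OF lab]
  have adj: "adj G (x s i) (x t j) \<longleftrightarrow>
        (s = t \<and> (j = Suc i \<or> i = Suc j)) \<or>
        (s \<noteq> t \<and> (i = 0 \<and> j = 0 \<or> Suc i = len s \<and> Suc j = len t))"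
    if "s < 3" "t < 3" "i < len s" "j < len t" for s t i j
    using prism_labellingD(5)[OF lab that] xW that by (simp add: adj_induced)
  have len: "even (len s)" "2 \<le> len s" if "s < 3" for s
    using prism_labellingD(1,2)[OF lab that] by (cases "len s = 1"; auto)+
  define C where "C s t u = {x a i | a i. a < 3 \<and> i < len a \<and>
      (a = s \<and> even i \<or> a = t \<and> odd i \<or> a = u \<and> odd i \<and> Suc i < len u)}" for s t u
  have mem: "x a i \<in> C s t u \<longleftrightarrow> a = s \<and> even i \<or> a = t \<and> odd i \<or> a = u \<and> odd i \<and> Suc i < len u"
    if "a < 3" "i < len a" for a i s t u
    using that inj unfolding C_def by blast
  have CW: "C s t u \<subseteq> W" for s t u unfolding C_def V by blast
  have stable: "C s t u \<in> stable_sets G" if stu: "s \<noteq> t" "t \<noteq> u" "s \<noteq> u" for s t u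
    unfolding stable_sets_def
  proof (intro CollectI conjI ballI notI)
    show "C s t u \<subseteq> verts G" using CW W by blast
    fix v w assume vw: "v \<in> C s t u" "w \<in> C s t u" "adj G v w"
    then obtain a i b j where ab: "v = x a i" "w = x b j" "a < 3" "b < 3" "i < len a" "j < len b"
      unfolding C_def by blast
    have ma: "a = s \<and> even i \<or> a = t \<and> odd i \<or> a = u \<and> odd i \<and> Suc i < len u"
      and mb: "b = s \<and> even j \<or> b = t \<and> odd j \<or> b = u \<and> odd j \<and> Suc j < len u"
      using vw(1,2) mem ab by blast+
    consider "a = b" "j = Suc i \<or> i = Suc j" | "a \<noteq> b" "i = 0" "j = 0"
      | "a \<noteq> b" "Suc i = len a" "Suc j = len b"
      using vw(3) adj[OF ab(3-6)] unfolding ab(1,2) by blast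
    then show False
    proof cases
      case 1
      then show False using ma mb stu by auto
    next
      case 2
      then show False using ma mb by auto
    next
      case 3
      then have "odd i" "odd j" using len(1)[OF ab(3)] len(1)[OF ab(4)] by (metis even_Suc)+
      then show False using 3 ma mb by auto
    qed
  qed
  have ne: "C s t u \<noteq> C s' t' u'"
    if "s < 3" "t < 3" "u < 3" "s' < 3" "t' < 3" "u' < 3" "s \<noteq> t" "t \<noteq> u" "s \<noteq> u"
       "s' \<noteq> t'" "t' \<noteq> u'" "s' \<noteq> u'" "s \<noteq> s' \<or> t \<noteq> t'" for s t u s' t' u'
  proof
    assume eq: "C s t u = C s' t' u'"
    have "x s 0 \<in> C s t u" using mem[of s 0 s t u] len[OF that(1)] that by auto
    then have "s = s'" unfolding eq using mem[of s 0 s' t' u'] len[OF that(1)] that by auto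
    define l where "l = len t - 1"
    have l: "l < len t" "odd l" "Suc l = len t" using len[OF that(2)] by (auto simp: l_def)
    have "x t l \<in> C s t u" using mem[of t l s t u] l that by auto
    then have "t = t' \<or> t = u' \<and> Suc l < len u'"
      unfolding eq using mem[OF that(2) l(1), of s' t' u'] that(7) \<open>s = s'\<close> by blast
    then have "t = t'" using l(3) by auto
    then show False using \<open>s = s'\<close> that by blast
  qed
  have conn: "edge_connected_on G ((C s t u - C t u s) \<union> (C t u s - C s t u))"
    if stu: "s < 3" "t < 3" "u < 3" "s \<noteq> t" "t \<noteq> u" "s \<noteq> u" for s t u
  proof (rule edge_connected_onI[of _ _ "x t 0"])
    let ?D = "(C s t u - C t u s) \<union> (C t u s - C s t u)"
    fix P :: "'a \<Rightarrow> bool"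
    assume P: "\<And>a b. \<lbrakk>a \<in> ?D; b \<in> ?D; adj G a b\<rbrakk> \<Longrightarrow> P a = P b"
    \<comment> \<open>The symmetric difference is the path \<open>t\<close>, the path \<open>s\<close> without its end, and the end
      of \<open>u\<close>; the value of \<open>P\<close> is carried to all of it from the first vertex of \<open>t\<close>.\<close>
    have D: "x a i \<in> ?D \<longleftrightarrow> a = t \<or> a = s \<and> Suc i < len s \<or> a = u \<and> Suc i = len u"
      if "a < 3" "i < len a" for a i
    proof -
      have end_odd: "Suc i = len a \<Longrightarrow> odd i" using len(1)[OF that(1)] by (metis even_Suc)
      have last_iff: "Suc i < len a \<longleftrightarrow> Suc i \<noteq> len a" using that(2) by auto
      consider "a = s" | "a = t" | "a = u" | "a \<noteq> s" "a \<noteq> t" "a \<noteq> u" by blast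
      then show ?thesis
        unfolding Un_iff Diff_iff mem[OF that] by cases (use stu end_odd last_iff in auto)
    qed
    have t: "P (x t i) = P (x t 0)" if "i < len t" for i
      using that
    proof (induction i)
      case (Suc i)
      then have "P (x t i) = P (x t (Suc i))"
        using stu adj[of t t i "Suc i"] D[of t i] D[of t "Suc i"] by (intro P) simp_all
      then show ?case using Suc by simp
    qed simp
    have s: "P (x s i) = P (x s 0)" if "Suc i < len s" for i
      using that
    proof (induction i)
      case (Suc i)
      then have "P (x s i) = P (x s (Suc i))"
        using stu adj[of s s i "Suc i"] D[of s i] D[of s "Suc i"] by (intro P) simp_all
      then show ?case using Suc by simp
    qed simp
    have st: "P (x s 0) = P (x t 0)"
      using stu adj[of s t 0 0] D[of s 0] D[of t 0] len[OF stu(1)] len[OF stu(2)] by (intro P) simp_all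
    have u: "P (x u i) = P (x t 0)" if i: "Suc i = len u" for i
    proof -
      define l where "l = len t - 1"
      have l: "l < len t" "Suc l = len t" using len(2)[OF stu(2)] by (auto simp: l_def)
      have "P (x u i) = P (x t l)"
        using stu adj[of u t i l] D[of u i] D[of t l] i l by (intro P) simp_all
      then show ?thesis using t[OF l(1)] by simp
    qed
    show "\<forall>a \<in> ?D. P a = P (x t 0)"
    proof
      fix a assume a: "a \<in> ?D"
      then have "a \<in> W" using CW by blast
      then obtain b i where b: "a = x b i" "b < 3" "i < len b" using V by blast
      then have "b = t \<or> b = s \<and> Suc i < len s \<or> b = u \<and> Suc i = len u" using a D by blast
      then show "P a = P (x t 0)" using b t s st u by auto
    qed
  qed
  let ?A = "{C 0 1 2, C 1 2 0, C 2 0 1}" and ?B = "{C 0 2 1, C 2 1 0, C 1 0 2}"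
  have distinct: "distinct [C 0 1 2, C 1 2 0, C 2 0 1]" "distinct [C 0 2 1, C 2 1 0, C 1 0 2]"
    using ne by simp_all
  show ?thesis
  proof (rule not_quadratic_if_rigid[OF G, of ?A ?B])
    show "?A \<subseteq> stable_sets G" "?B \<subseteq> stable_sets G" using stable by simp_all
    have "C 0 1 2 \<notin> ?B" using ne by simp
    then show "?A \<noteq> ?B" by blast
    show "card ?A = card ?B" using distinct by simp
    show "card {S \<in> ?A. v \<in> S} = card {S \<in> ?B. v \<in> S}" for v
    proof (cases "v \<in> W")
      case True
      then obtain a i where v: "v = x a i" "a < 3" "i < len a" using V by blast
      then show ?thesis
        unfolding card_filter_insert3[OF distinct(1)] card_filter_insert3[OF distinct(2)] v(1)
          mem[OF v(2,3)]
        by (auto simp: less_3_cases)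
    next
      case False
      then have "v \<notin> C s t u" for s t u using CW by blast
      then show ?thesis
        unfolding card_filter_insert3[OF distinct(1)] card_filter_insert3[OF distinct(2)] by simp
    qed
    show "edge_connected_on G ((S - T) \<union> (T - S))" if "S \<in> ?A" "T \<in> ?A" "S \<noteq> T" for S T
      using that conn[of 0 1 2] conn[of 1 2 0] conn[of 2 0 1] by (auto simp: Un_commute)
  qed simp_all
qed

section \<open>Odd holes and antiholes in perfect graphs\<close>

text \<open>Colour the subgraph induced on \<open>W\<close> with as many colours as its largest clique has elements; the
  classes are stable.\<close>

lemma perfect_card_le:
  assumes G: "simple_graph G" "perfect G" and W: "W \<subseteq> verts G"
    and stable: "\<And>S. S \<subseteq> W \<Longrightarrow> (\<forall>u \<in> S. \<forall>v \<in> S. \<not> adj G u v) \<Longrightarrow> card S \<le> a"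
    and clique: "\<And>C. C \<subseteq> W \<Longrightarrow> (\<forall>u \<in> C. \<forall>v \<in> C. u \<noteq> v \<longrightarrow> adj G u v) \<Longrightarrow> card C \<le> b"
  shows "card W \<le> a * b"
proof -
  define F where "F = induced G W"
  define k where "k = chromatic_number F"
  have fin: "finite W" using G(1) W by (auto simp: simple_graph_def intro: finite_subset)
  obtain h where h: "bij_betw h W {0..<card W}" using ex_bij_betw_finite_nat[OF fin] by blast
  have "colourable F (card W)"
    unfolding colourable_def
  proof (intro exI[of _ h] conjI ballI impI)
    fix v assume "v \<in> verts F"
    then show "h v < card W" using h by (auto simp: F_def bij_betw_def)
  next
    fix u v assume "u \<in> verts F" "v \<in> verts F" "adj F u v"
    moreover from this have "u \<noteq> v" using simple_graph_adjD[OF G(1)] by (auto simp: F_def adj_induced)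
    ultimately show "h u \<noteq> h v" using h by (auto simp: F_def bij_betw_def inj_on_def)
  qed
  then have "colourable F k" unfolding k_def chromatic_number_def by (rule LeastI)
  then obtain c where c: "\<And>v. v \<in> W \<Longrightarrow> c v < k" "\<And>u v. u \<in> W \<Longrightarrow> v \<in> W \<Longrightarrow> adj G u v \<Longrightarrow> c u \<noteq> c v"
    unfolding colourable_def by (auto simp: F_def adj_induced)
  have "W = (\<Union>i<k. {v \<in> W. c v = i})" using c(1) by blast
  then have "card W = card (\<Union>i<k. {v \<in> W. c v = i})" by simp
  also have "\<dots> \<le> (\<Sum>i<k. card {v \<in> W. c v = i})" by (rule card_UN_le) simp
  also have "\<dots> \<le> (\<Sum>i<k. a)"
  proof (rule sum_mono, rule stable)
    show "\<forall>u \<in> {v \<in> W. c v = i}. \<forall>v \<in> {v \<in> W. c v = i}. \<not> adj G u v" for i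
      using c(2) by blast
  qed blast
  also have "\<dots> = a * k" by simp
  also have "\<dots> \<le> a * b"
  proof (rule mult_le_mono2)
    have "k = clique_number F" using G(2) W by (simp add: perfect_def k_def F_def)
    also have "\<dots> \<le> b"
      unfolding clique_number_def
    proof (rule Max.boundedI)
      have "cliques F \<subseteq> Pow W" by (auto simp: cliques_def F_def)
      then show "finite (card ` cliques F)" using fin by (meson finite_Pow_iff finite_imageI finite_subset)
      have "{} \<in> cliques F" by (simp add: cliques_def complete_graph_def)
      then show "card ` cliques F \<noteq> {}" by blast
      fix l assume "l \<in> card ` cliques F"
      then obtain C where C: "l = card C" "C \<in> cliques F" by blast
      then show "l \<le> b"
        using clique[of C] by (auto simp: cliques_def complete_graph_def F_def adj_induced)
    qed
    finally show "k \<le> b" .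
  qed
  finally show ?thesis .
qed

text \<open>The successors of a stable set in the cyclic order form a disjoint set of the same size.\<close>

lemma cycle_stable_card:
  assumes f: "bij_betw f {..<n} W" and n: "0 < n" and S: "S \<subseteq> W"
    and stable: "\<And>i. i < n \<Longrightarrow> f i \<in> S \<Longrightarrow> f (Suc i mod n) \<notin> S"
  shows "2 * card S \<le> n"
proof -
  define I where "I = {i. i < n \<and> f i \<in> S}"
  have fin: "finite I" by (simp add: I_def)
  have S_eq: "S = f ` I" using S f by (auto simp: I_def bij_betw_def)
  have "inj_on f I" using f by (auto simp: I_def bij_betw_def inj_on_def)
  then have cI: "card S = card I" unfolding S_eq by (rule card_image)
  have "inj_on (\<lambda>i. Suc i mod n) I"
    using mod_Suc_cases[of _ n] by (auto simp: inj_on_def I_def split: if_splits)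
  then have "card ((\<lambda>i. Suc i mod n) ` I) = card I" by (rule card_image)
  moreover have "I \<inter> (\<lambda>i. Suc i mod n) ` I = {}" using stable by (auto simp: I_def)
  moreover have "I \<union> (\<lambda>i. Suc i mod n) ` I \<subseteq> {..<n}" using n by (auto simp: I_def)
  then have "card (I \<union> (\<lambda>i. Suc i mod n) ` I) \<le> n" using card_mono[of "{..<n}"] by fastforce
  ultimately show ?thesis using cI fin by (simp add: card_Un_disjoint)
qed

text \<open>Three pairwise consecutive positions would return to the start after three steps.\<close>

lemma cycle_clique_card:
  assumes f: "bij_betw f {..<n} W" and n: "4 \<le> n" and C: "C \<subseteq> W"
    and clique: "\<And>i j. \<lbrakk>i < n; j < n; i \<noteq> j; f i \<in> C; f j \<in> C\<rbrakk> \<Longrightarrow> j = Suc i mod n \<or> i = Suc j mod n"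
  shows "card C \<le> 2"
proof (rule ccontr)
  assume "\<not> card C \<le> 2"
  then obtain T where "T \<subseteq> C" "card T = 3"
    using obtain_subset_with_card_n[of 3 C] by (metis not_less_eq_eq numeral_2_eq_2 numeral_3_eq_3)
  then obtain u v w where uvw: "u \<in> C" "v \<in> C" "w \<in> C" "u \<noteq> v" "v \<noteq> w" "u \<noteq> w"
    by (auto simp: card_3_iff)
  have index: "\<exists>i<n. v = f i" if "v \<in> C" for v
    using that C f by (auto simp: bij_betw_def)
  obtain i j l where ijl: "i < n" "j < n" "l < n" "u = f i" "v = f j" "w = f l"
    using index[OF uvw(1)] index[OF uvw(2)] index[OF uvw(3)] by blast
  define s where "s i = Suc i mod n" for i
  have d: "i \<noteq> j" "j \<noteq> l" "l \<noteq> i" using ijl uvw by auto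
  have r: "j = s i \<or> i = s j" "l = s j \<or> j = s l" "i = s l \<or> l = s i"
    unfolding s_def
    using clique[OF ijl(1,2) d(1)] clique[OF ijl(2,3) d(2)] clique[OF ijl(3,1) d(3)] ijl(4-6) uvw(1-3)
    by simp_all
  have inj: "s a = s b \<Longrightarrow> a = b" if "a < n" "b < n" for a b
    using mod_Suc_cases[OF that(1)] mod_Suc_cases[OF that(2)] that by (auto simp: s_def split: if_splits)
  have no: "s (s (s a)) \<noteq> a" if "a < n" for a
  proof
    assume "s (s (s a)) = a"
    moreover have "s (s (s a)) = (a + 3) mod n" by (simp add: s_def mod_simps eval_nat_numeral)
    ultimately have "(a + 3) mod n = a mod n" using that mod_less by metis
    then have "n dvd 3" by (simp add: mod_eq_dvd_iff_nat)
    then show False using n by (auto dest: dvd_imp_le)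
  qed
  show False
    using r d inj[OF ijl(1,3)] inj[OF ijl(2,3)] no[OF ijl(1)] no[OF ijl(3)] by auto
qed

text \<open>A cycle of odd length \<open>n\<close> has stable sets of size at most \<open>(n - 1) / 2\<close> and cliques of size at
  most \<open>2\<close>, too small for \<open>perfect_card_le\<close>.\<close>

lemma perfect_no_odd_hole:
  assumes G: "simple_graph G" "perfect G"
  shows "\<not> contains_induced is_odd_hole G"
proof
  assume "contains_induced is_odd_hole G"
  then obtain W n where W: "W \<subseteq> verts G" and n: "5 \<le> n" "odd n" "is_cycle n (induced G W)"
    unfolding contains_induced_def is_odd_hole_def by blast
  obtain f where f: "bij_betw f {..<n} W"
    and adj: "\<And>i j. i < n \<Longrightarrow> j < n \<Longrightarrow> adj (induced G W) (f i) (f j) \<longleftrightarrow> j = Suc i mod n \<or> i = Suc j mod n"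
    using cycle_vertices[OF n(3)] by (metis verts_induced)
  have fW: "f i \<in> W" if "i < n" for i using f that by (auto simp: bij_betw_def)
  have adj: "adj G (f i) (f j) \<longleftrightarrow> j = Suc i mod n \<or> i = Suc j mod n" if "i < n" "j < n" for i j
    using adj[OF that] fW that by (simp add: adj_induced)
  have "card W \<le> (n div 2) * 2"
  proof (rule perfect_card_le[OF G W])
    fix S assume S: "S \<subseteq> W" "\<forall>u \<in> S. \<forall>v \<in> S. \<not> adj G u v"
    have "2 * card S \<le> n"
    proof (rule cycle_stable_card[OF f _ S(1)])
      fix i assume "i < n" "f i \<in> S"
      then show "f (Suc i mod n) \<notin> S" using S(2) adj[of i "Suc i mod n"] n by auto
    qed (use n in simp)
    then show "card S \<le> n div 2" by simp
  next
    fix C assume C: "C \<subseteq> W" "\<forall>u \<in> C. \<forall>v \<in> C. u \<noteq> v \<longrightarrow> adj G u v"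
    show "card C \<le> 2"
    proof (rule cycle_clique_card[OF f _ C(1)])
      fix i j assume ij: "i < n" "j < n" "i \<noteq> j" "f i \<in> C" "f j \<in> C"
      then have "f i \<noteq> f j" using f by (auto simp: bij_betw_def inj_on_def)
      then show "j = Suc i mod n \<or> i = Suc j mod n" using C(2) adj ij by blast
    qed (use n in simp)
  qed
  moreover have "card W = n" using bij_betw_same_card[OF f] by simp
  ultimately show False using n(2) by presburger
qed

text \<open>The argument for odd holes with stable sets and cliques interchanged.\<close>

lemma perfect_antihole_even:
  assumes G: "simple_graph G" "perfect G" and W: "W \<subseteq> verts G"
    and n: "5 \<le> n" and f: "bij_betw f {..<n} W"
    and adj: "\<And>i j. i < n \<Longrightarrow> j < n \<Longrightarrow> i \<noteq> j \<Longrightarrow>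
       adj G (f i) (f j) \<longleftrightarrow> \<not> (j = Suc i mod n \<or> i = Suc j mod n)"
  shows "even n"
proof (rule ccontr)
  assume odd: "odd n"
  have "card W \<le> 2 * (n div 2)"
  proof (rule perfect_card_le[OF G W])
    fix S assume S: "S \<subseteq> W" "\<forall>u \<in> S. \<forall>v \<in> S. \<not> adj G u v"
    show "card S \<le> 2"
    proof (rule cycle_clique_card[OF f _ S(1)])
      fix i j assume ij: "i < n" "j < n" "i \<noteq> j" "f i \<in> S" "f j \<in> S"
      then show "j = Suc i mod n \<or> i = Suc j mod n" using S(2) adj[OF ij(1-3)] by blast
    qed (use n in simp)
  next
    fix C assume C: "C \<subseteq> W" "\<forall>u \<in> C. \<forall>v \<in> C. u \<noteq> v \<longrightarrow> adj G u v"
    have "2 * card C \<le> n"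
    proof (rule cycle_stable_card[OF f _ C(1)])
      fix i assume i: "i < n" "f i \<in> C"
      have s: "Suc i mod n < n" "i \<noteq> Suc i mod n"
        using n mod_Suc_cases[OF i(1)] i(1) by (auto split: if_splits)
      then have "f i \<noteq> f (Suc i mod n)" using i f by (auto simp: bij_betw_def inj_on_def)
      then show "f (Suc i mod n) \<notin> C" using C(2) adj[OF i(1) s] i by blast
    qed (use n in simp)
    then show "card C \<le> n div 2" by simp
  qed
  moreover have "card W = n" using bij_betw_same_card[OF f] by simp
  ultimately show False using odd by presburger
qed

lemma perfect_quadratic_no_antihole:
  assumes G: "simple_graph G" "perfect G" and quad: "quadratic_stable_set_ring (K :: 'k::field itself) G"
  shows "\<not> contains_induced is_antihole G"
proof
  assume "contains_induced is_antihole G"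
  then obtain W where W: "W \<subseteq> verts G" "is_antihole (induced G W)"
    unfolding contains_induced_def by blast
  obtain n f where n: "5 \<le> n" and f: "bij_betw f {..<n} W"
    and adj: "\<And>i j. i < n \<Longrightarrow> j < n \<Longrightarrow> i \<noteq> j \<Longrightarrow>
       adj (induced G W) (f i) (f j) \<longleftrightarrow> \<not> (j = Suc i mod n \<or> i = Suc j mod n)"
    using antihole_vertices[OF W(2)] by (metis verts_induced)
  have fW: "f i \<in> W" if "i < n" for i using f that by (auto simp: bij_betw_def)
  have adj: "adj G (f i) (f j) \<longleftrightarrow> \<not> (j = Suc i mod n \<or> i = Suc j mod n)"
    if "i < n" "j < n" "i \<noteq> j" for i j
    using adj[OF that] fW that by (simp add: adj_induced)
  have "even n" by (rule perfect_antihole_even[OF G W(1) n f adj])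
  then obtain m where m: "n = 2 * m" by (elim evenE)
  have "\<not> quadratic_stable_set_ring K G"
    by (rule even_antihole_not_quadratic[OF G(1) W(1), of m f])
      (use n f adj in \<open>simp_all add: m\<close>)
  then show False using quad by blast
qed

section \<open>The equivalence\<close>

lemma induced_verts: "simple_graph G \<Longrightarrow> induced G (verts G) = G"
  by (cases G) (auto simp: induced_def simple_graph_def)

theorem theorem1p4:
  fixes K :: "'k::field itself"
  assumes conjecture_A:
    "\<forall>G :: nat graph. simple_graph G \<longrightarrow>
       (perfectly_contractile G \<longleftrightarrow>
          \<not> contains_induced is_odd_hole G \<and>
          \<not> contains_induced is_antihole G \<and>
          \<not> contains_induced is_odd_prism G)"
  shows
    "\<forall>G :: nat graph. simple_graph G \<and> perfect G \<longrightarrow>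
       (quadratic_stable_set_ring K G \<longleftrightarrow>
          \<not> contains_induced is_odd_hole G \<and>
          \<not> contains_induced is_antihole G \<and>
          \<not> contains_induced is_odd_prism G)"
proof (intro allI impI iffI)
  fix G :: "nat graph" assume G: "simple_graph G \<and> perfect G"
  assume quad: "quadratic_stable_set_ring K G"
  have "\<not> contains_induced is_odd_prism G"
    using odd_prism_not_quadratic[of G _ K] G quad unfolding contains_induced_def by blast
  then show "\<not> contains_induced is_odd_hole G \<and> \<not> contains_induced is_antihole G \<and>
      \<not> contains_induced is_odd_prism G"
    using perfect_no_odd_hole perfect_quadratic_no_antihole G quad by blast
next
  fix G :: "nat graph" assume G: "simple_graph G \<and> perfect G"
  assume free: "\<not> contains_induced is_odd_hole G \<and> \<not> contains_induced is_antihole G \<and>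
      \<not> contains_induced is_odd_prism G"
  show "quadratic_stable_set_ring K G"
  proof (rule quadratic_if_kempe_equivalent)
    show "simple_graph G" using G by blast
    fix H :: "nat graph" and \<pi> k c d
    assume H: "is_replication H G \<pi>" and cd: "proper_colouring H k c" "proper_colouring H k d"
    have simple: "simple_graph H" using H by (simp add: is_replication_def)
    have "perfectly_contractile H"
      using conjecture_A simple forbidden_replication[OF conjunct1[OF G] H] free by blast
    then have "even_contractile (induced H (verts H))"
      unfolding perfectly_contractile_def by blast
    then have "even_contractile H" using simple by (simp add: induced_verts)
    then show "(kempe_step H k)\<^sup>*\<^sup>* c d"
      by (rule even_contractile_kempe_equivalent[OF _ simple cd])
  qed
qed

end
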